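(* Let $1<p<\infty$ and $p'=p/(p-1)$. There is a finite constant $C_{p'}$, depending only on $p'$, such that for every Banach space $X$, every $n\ge1$ and every function $F:\Omega_n\times\Omega_n\to X$, setting $$F_j(\varepsilon)=\mathbb E_\delta[\delta_jF(\varepsilon,\delta)],\qquad 1\le j\le n,$$ one has $$\left(\mathbb E_\varepsilon\left\|\sum_{j=1}^n\Delta^{-1}D_jF_j(\varepsilon)\right\|_X^p\right)^{1/p}\le C_{p'}\sqrt n\,\left(\mathbb E_{\varepsilon,\delta}\|F(\varepsilon,\delta)\|_X^p\right)^{1/p}.$$
   Context: $\Omega_n=\{-1,1\}^n$ carries the uniform probability measure; $\varepsilon$ and $\delta=(\delta_1,\dots,\delta_n)$ are independent uniformly distributed points of $\Omega_n$, and subscripts on $\mathbb E$ indicate the variables over which expectation is taken. For $A\subseteq\{1,\dots,n\}$ the Walsh character is $W_A(\varepsilon)=\prod_{j\in A}\varepsilon_j$, $W_\varnothing\equiv 1$. Every $f:\Omega_n\to X$ has the expansion $f=\sum_A\widehat f(A)W_A$ with $\widehat f(A)=\mathbb E_\varepsilon W_A(\varepsilon)f(\varepsilon)\in X$. The following operators are defined on $X$-valued functions by their action on Walsh characters, extended linearly: $D_jW_A=\mathbf 1_{\{j\in A\}}W_A$; $\Delta=\sum_{j=1}^nD_j$, so $\Delta W_A=|A|W_A$; $\Delta^{-1}W_A=|A|^{-1}W_A$ for $A\ne\varnothing$ and $\Delta^{-1}W_\varnothing=0$. *)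

theory Defs
  imports "HOL-Analysis.Analysis"
begin

definition cube :: "nat \<Rightarrow> (nat \<Rightarrow> real) set" where
  "cube n = {1..n} \<rightarrow>\<^sub>E {-1, 1}"

(* Expectation under the uniform probability measure on the cube. A finite average is used because
   the Bochner integral of the library requires a second countable codomain. *)
definition cube_expect :: "nat \<Rightarrow> ((nat \<Rightarrow> real) \<Rightarrow> 'a::real_vector) \<Rightarrow> 'a" where
  "cube_expect n f = (\<Sum>\<epsilon>\<in>cube n. f \<epsilon>) /\<^sub>R real (card (cube n))"

definition walsh :: "nat set \<Rightarrow> (nat \<Rightarrow> real) \<Rightarrow> real" where
  "walsh A \<epsilon> = (\<Prod>j\<in>A. \<epsilon> j)"

definition walsh_coeff :: "nat \<Rightarrow> ((nat \<Rightarrow> real) \<Rightarrow> 'a::real_vector) \<Rightarrow> nat set \<Rightarrow> 'a" where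
  "walsh_coeff n f A = cube_expect n (\<lambda>\<epsilon>. walsh A \<epsilon> *\<^sub>R f \<epsilon>)"

(* The linear operator acting on Walsh characters by W_A \<mapsto> m A * W_A;
   see walsh_multiplier_walsh below. *)
definition walsh_multiplier ::
  "nat \<Rightarrow> (nat set \<Rightarrow> real) \<Rightarrow> ((nat \<Rightarrow> real) \<Rightarrow> 'a::real_vector) \<Rightarrow> (nat \<Rightarrow> real) \<Rightarrow> 'a" where
  "walsh_multiplier n m f \<epsilon> = (\<Sum>A\<in>Pow {1..n}. (m A * walsh A \<epsilon>) *\<^sub>R walsh_coeff n f A)"

definition cube_D ::
  "nat \<Rightarrow> nat \<Rightarrow> ((nat \<Rightarrow> real) \<Rightarrow> 'a::real_vector) \<Rightarrow> (nat \<Rightarrow> real) \<Rightarrow> 'a" where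
  "cube_D n j = walsh_multiplier n (\<lambda>A. if j \<in> A then 1 else 0)"

definition cube_Laplacian_inv ::
  "nat \<Rightarrow> ((nat \<Rightarrow> real) \<Rightarrow> 'a::real_vector) \<Rightarrow> (nat \<Rightarrow> real) \<Rightarrow> 'a" where
  "cube_Laplacian_inv n = walsh_multiplier n (\<lambda>A. if A = {} then 0 else 1 / real (card A))"

definition cube_proj ::
  "nat \<Rightarrow> nat \<Rightarrow> ((nat \<Rightarrow> real) \<Rightarrow> (nat \<Rightarrow> real) \<Rightarrow> 'a::real_vector) \<Rightarrow> (nat \<Rightarrow> real) \<Rightarrow> 'a" where
  "cube_proj n j F \<epsilon> = cube_expect n (\<lambda>\<delta>. \<delta> j *\<^sub>R F \<epsilon> \<delta>)"

(* HOL cannot quantify over all Banach spaces under an existential quantifier for the constant,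
   so the constant has to be a closed term not mentioning the Banach space. We take the optimal
   constant for functions with values in the bounded sequences l^\<infinity>, with p = p' / (p' - 1).
   As F has only finitely many values and every separable Banach space embeds isometrically in
   l^\<infinity>, this is also the optimal constant for all Banach spaces together. If no constant worked
   for l^\<infinity>, the value would be an arbitrary real, and the inequality with this constant would
   then be false for l^\<infinity>; so an inequality for all Banach spaces with this constant
   does assert that a finite constant exists. *)
definition optimal_constant :: "real \<Rightarrow> real" where
  "optimal_constant p' = Inf {C. 0 \<le> C \<and>
     (\<forall>n\<ge>1. \<forall>F :: (nat \<Rightarrow> real) \<Rightarrow> (nat \<Rightarrow> real) \<Rightarrow> (nat \<Rightarrow>\<^sub>C real).
        let p = p' / (p' - 1) in
        cube_expect n (\<lambda>\<epsilon>.
            norm (\<Sum>j=1..n. cube_Laplacian_inv n (cube_D n j (cube_proj n j F)) \<epsilon>) powr p) powr (1 / p)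
        \<le> C * sqrt (real n) *
          cube_expect n (\<lambda>\<epsilon>. cube_expect n (\<lambda>\<delta>. norm (F \<epsilon> \<delta>) powr p)) powr (1 / p))}"

lemma finite_cube [simp]: "finite (cube n)"
  by (simp add: cube_def finite_PiE)

lemma card_cube: "card (cube n) = 2 ^ n"
  by (simp add: cube_def card_PiE numeral_2_eq_2)

lemma walsh_orthogonal:
  assumes "A \<subseteq> {1..n}" "B \<subseteq> {1..n}"
  shows "cube_expect n (\<lambda>\<epsilon>. walsh A \<epsilon> * walsh B \<epsilon>) = (if A = B then 1 else 0)"
proof -
  define g :: "nat \<Rightarrow> real \<Rightarrow> real"
    where "g j x = (if j \<in> A then x else 1) * (if j \<in> B then x else 1)" for j x
  have w: "walsh S \<epsilon> = (\<Prod>j=1..n. if j \<in> S then \<epsilon> j else 1)" if "S \<subseteq> {1..n}" for S \<epsilon>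
    using that by (simp add: walsh_def prod.If_cases Int_absorb1)
  have "(\<Sum>\<epsilon>\<in>cube n. walsh A \<epsilon> * walsh B \<epsilon>) = (\<Sum>\<epsilon>\<in>cube n. \<Prod>j=1..n. g j (\<epsilon> j))"
    using assms by (simp add: w g_def prod.distrib)
  also have "\<dots> = (\<Prod>j=1..n. \<Sum>x\<in>{-1, 1}. g j x)"
    unfolding cube_def by (rule prod_sum_PiE [symmetric]) auto
  also have "\<dots> = (\<Prod>j=1..n. if j \<in> A \<longleftrightarrow> j \<in> B then 2 else 0)"
    by (rule prod.cong) (auto simp: g_def)
  also have "\<dots> = (if A = B then 2 ^ n else 0)"
  proof (cases "A = B")
    case False
    then obtain j where "j \<in> {1..n}" "\<not> (j \<in> A \<longleftrightarrow> j \<in> B)"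
      using assms by blast
    then have "(\<Prod>j=1..n. if j \<in> A \<longleftrightarrow> j \<in> B then 2 else 0 :: real) = 0"
      by (intro prod_zero) auto
    then show ?thesis using False by simp
  qed simp
  finally show ?thesis
    by (simp add: cube_expect_def card_cube)
qed

lemma walsh_multiplier_walsh:
  fixes x :: "'a::real_vector"
  assumes "B \<subseteq> {1..n}"
  shows "walsh_multiplier n m (\<lambda>\<epsilon>. walsh B \<epsilon> *\<^sub>R x) \<epsilon> = (m B * walsh B \<epsilon>) *\<^sub>R x"
proof -
  have c: "walsh_coeff n (\<lambda>\<epsilon>. walsh B \<epsilon> *\<^sub>R x) A = (if A = B then x else 0)" if "A \<subseteq> {1..n}" for A
  proof -
    have "walsh_coeff n (\<lambda>\<epsilon>. walsh B \<epsilon> *\<^sub>R x) A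
        = cube_expect n (\<lambda>\<epsilon>. walsh A \<epsilon> * walsh B \<epsilon>) *\<^sub>R x"
      by (simp add: walsh_coeff_def cube_expect_def flip: scaleR_sum_left)
    then show ?thesis
      using walsh_orthogonal [OF that assms] by simp
  qed
  have "walsh_multiplier n m (\<lambda>\<epsilon>. walsh B \<epsilon> *\<^sub>R x) \<epsilon>
      = (\<Sum>A\<in>Pow {1..n}. if A = B then (m A * walsh A \<epsilon>) *\<^sub>R x else 0)"
    unfolding walsh_multiplier_def by (rule sum.cong) (auto simp: c)
  also have "\<dots> = (m B * walsh B \<epsilon>) *\<^sub>R x"
    using assms by (subst sum.delta) auto
  finally show ?thesis .
qed

end

theory Submission
  imports Defs "HOL-Probability.Hoeffding"
begin

text \<open>Write \<open>L \<epsilon>\<close> for the sum on the left-hand side. Inverting \<open>\<Delta>\<close> by \<open>1 / k = \<integral>\<^sub>0\<^sup>1 r\<^sup>k\<^sup>-\<^sup>1 dr\<close>, where \<open>k\<close>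
  is the size of the index set of a Walsh function, represents \<open>\<Delta>\<^sup>-\<^sup>1 D\<^sub>j\<close> as an average over
  \<open>r \<in> [0, 1]\<close> of the operators \<open>D\<^sub>j P\<^sub>r / r\<close>. Here \<open>P\<^sub>r\<close> is the noise semigroup, which multiplies
  a Walsh function by \<open>r\<^sup>k\<close>. The kernel \<open>poisson_kernel n r\<close>
  of \<open>P\<^sub>r\<close> is a product probability density, and differentiating
  it in direction \<open>j\<close> only multiplies it by a scalar
  (\<open>gradient_kernel_eq_poisson\<close>): the kernel of \<open>D\<^sub>j P\<^sub>r / r\<close> is \<open>(\<epsilon>\<^sub>j \<eta>\<^sub>j - r) / (1 - r\<^sup>2)\<close> times the
  Poisson kernel. Therefore \<open>L \<epsilon>\<close> is the integral over \<open>r\<close> of the Poisson average over \<open>\<eta>\<close> and the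
  uniform average over \<open>\<delta>\<close> of
  \<open>h (\<epsilon>, \<eta>, \<delta>) / (1 - r\<^sup>2)\<close> times \<open>F \<eta> \<delta>\<close>, with the scalar weight \<open>h = (\<Sum>j. (\<epsilon>\<^sub>j \<eta>\<^sub>j - r) \<delta>\<^sub>j)\<close>.
  No geometry of the Banach space is involved any more: taking norms inside and applying Hoelder's
  inequality leaves the scalar quantity \<open>(E |h|\<^sup>q)\<^sup>1\<^sup>/\<^sup>q\<close> with \<open>q = p'\<close>.

  By Khintchine's inequality in \<open>\<delta>\<close>, this is of order \<open>\<surd>n\<close> times the \<open>q\<close>-norm of a single variable
  \<open>\<epsilon>\<^sub>j \<eta>\<^sub>j - r\<close> (or its 2-norm, if \<open>q < 2\<close>). Under the Poisson kernel this variable has modulus \<open>1 - r\<close>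
  except with probability \<open>(1 - r) / 2\<close>, whence \<open>gradient_field_norm\<close>: the norm of \<open>h\<close> is at most
  a constant times \<open>\<surd>n (1 - r)\<^sup>1\<^sup>/\<^sup>Q\<close> with \<open>Q = max q 2\<close>. After division by
  \<open>1 - r\<^sup>2\<close> the singularity \<open>(1 - r)\<^sup>1\<^sup>/\<^sup>Q\<^sup>-\<^sup>1\<close> at \<open>r = 1\<close> is integrable, with integral \<open>Q\<close>. The result is
  \<open>cube_inequality_with_constant\<close>, valid in every normed space with an explicit constant.

  Consequently the infimum in \<open>optimal_constant\<close> is taken over a nonempty set, and it satisfies the
  inequality for functions with values in \<open>l\<^sup>\<infinity>\<close>. An arbitrary Banach space is reduced to \<open>l\<^sup>\<infinity>\<close> by the
  Hahn-Banach theorem (\<open>norming_functional\<close>): norming functionals for the finitely many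
  values of \<open>L\<close> are the coordinates of a linear contraction into \<open>l\<^sup>\<infinity>\<close> which preserves the norms of
  these values and commutes with all the operators.\<close>

section \<open>Hoelder and Jensen inequalities for finite sums\<close>

lemma holder_sum:
  fixes w a b :: "'i \<Rightarrow> real"
  assumes S: "finite S" and pq: "p > 1" "q > 1" "1 / p + 1 / q = 1"
    and w: "\<And>i. i \<in> S \<Longrightarrow> 0 \<le> w i" and a: "\<And>i. i \<in> S \<Longrightarrow> 0 \<le> a i"
    and b: "\<And>i. i \<in> S \<Longrightarrow> 0 \<le> b i"
  shows "(\<Sum>i\<in>S. w i * (a i * b i))
    \<le> (\<Sum>i\<in>S. w i * a i powr p) powr (1 / p) * (\<Sum>i\<in>S. w i * b i powr q) powr (1 / q)"
proof -
  define A where "A = (\<Sum>i\<in>S. w i * a i powr p)"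
  define B where "B = (\<Sum>i\<in>S. w i * b i powr q)"
  have nonneg: "A \<ge> 0" "B \<ge> 0"
    unfolding A_def B_def using w by (auto intro!: sum_nonneg)
  show ?thesis
  proof (cases "A = 0 \<or> B = 0")
    case True
    then have "w i * (a i * b i) = 0" if "i \<in> S" for i
      using that sum_nonneg_eq_0_iff[OF S, of "\<lambda>i. w i * a i powr p"]
        sum_nonneg_eq_0_iff[OF S, of "\<lambda>i. w i * b i powr q"] w
      by (auto simp: A_def B_def)
    then have "(\<Sum>i\<in>S. w i * (a i * b i)) = 0"
      by (intro sum.neutral) auto
    then show ?thesis
      by simp
  next
    case False
    then have pos: "A > 0" "B > 0"
      using nonneg by auto
    define u where "u = A powr (1 / p)"
    define v where "v = B powr (1 / q)"
    have uv: "u > 0" "v > 0" "u powr p = A" "v powr q = B"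
      using pos pq by (auto simp: u_def v_def powr_powr)
    have "(\<Sum>i\<in>S. w i * (a i * b i)) / (u * v) = (\<Sum>i\<in>S. w i * ((a i / u) * (b i / v)))"
      by (simp add: sum_divide_distrib)
    also have "\<dots> \<le> (\<Sum>i\<in>S. w i * ((a i / u) powr p / p + (b i / v) powr q / q))"
      using w a b uv pq by (intro sum_mono mult_left_mono Youngs_inequality) auto
    also have "\<dots> = (\<Sum>i\<in>S. (w i * a i powr p) / (A * p) + (w i * b i powr q) / (B * q))"
      using a b uv by (intro sum.cong) (auto simp: powr_divide field_simps)
    also have "\<dots> = 1 / p + 1 / q"
      using pos by (simp add: sum.distrib A_def[symmetric] B_def[symmetric] flip: sum_divide_distrib)
    finally have "(\<Sum>i\<in>S. w i * (a i * b i)) \<le> u * v"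
      using uv pq by (simp add: field_simps)
    then show ?thesis
      by (simp add: u_def v_def A_def B_def)
  qed
qed

lemma power_mean_sum:
  fixes w y :: "'i \<Rightarrow> real"
  assumes S: "finite S" and s: "s \<ge> 1"
    and w: "\<And>i. i \<in> S \<Longrightarrow> 0 \<le> w i" "sum w S = 1" and y: "\<And>i. i \<in> S \<Longrightarrow> 0 \<le> y i"
  shows "(\<Sum>i\<in>S. w i * y i) powr s \<le> (\<Sum>i\<in>S. w i * y i powr s)"
proof (cases "s = 1")
  case True
  then show ?thesis
    using w y by (simp add: sum_nonneg)
next
  case False
  have "(\<Sum>i\<in>S. w i * (y i * 1)) \<le> (\<Sum>i\<in>S. w i * y i powr s) powr (1 / s) *
      (\<Sum>i\<in>S. w i * 1 powr (s / (s - 1))) powr (1 / (s / (s - 1)))"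
    using False s w y S by (intro holder_sum) (auto simp: field_simps)
  then have "(\<Sum>i\<in>S. w i * y i) \<le> (\<Sum>i\<in>S. w i * y i powr s) powr (1 / s)"
    using w by simp
  then have "(\<Sum>i\<in>S. w i * y i) powr s \<le> ((\<Sum>i\<in>S. w i * y i powr s) powr (1 / s)) powr s"
    using s w y by (intro powr_mono2) (auto intro!: sum_nonneg)
  then show ?thesis
    using s w y by (simp add: powr_powr sum_nonneg)
qed

section \<open>Khintchine's inequality\<close>

text \<open>This is the estimate behind Hoeffding's lemma for a variable that is \<open>0\<close> or \<open>2 x\<close>, each with
  probability \<open>1 / 2\<close>: subtracting its mean \<open>x\<close> leaves \<open>x\<close> or \<open>- x\<close>.\<close>

lemma cosh_le_exp_half_square:
  fixes x :: real
  shows "cosh x \<le> exp (x\<^sup>2 / 2)"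
proof -
  have *: "cosh x \<le> exp (x\<^sup>2 / 2)" if "x \<ge> 0" for x :: real
  proof -
    have "exp (2 * x) = exp x * exp x"
      by (simp flip: exp_add)
    then have "1 + 1 / 2 * (exp (2 * x) - 1) = exp x * cosh x"
      by (simp add: cosh_def algebra_simps exp_minus)
    then have "- (2 * x) * (1 / 2) + ln (exp x * cosh x) \<le> (2 * x)\<^sup>2 / 8"
      using Hoeffdings_lemma_aux[of "2 * x" "1 / 2"] that by simp
    then have "ln (cosh x) \<le> x\<^sup>2 / 2"
      by (simp add: ln_mult power2_eq_square cosh_real_pos)
    then show ?thesis
      using cosh_real_pos[of x] by (metis exp_ln exp_le_cancel_iff)
  qed
  show ?thesis
    using *[of x] *[of "- x"] by (cases "x \<ge> 0") auto
qed

text \<open>The constant comes from raising \<open>t \<le> exp t\<close>, for \<open>t = |x| / q\<close>, to the power \<open>q\<close>.\<close>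

lemma abs_powr_le_cosh:
  fixes x q :: real
  assumes "q > 0"
  shows "\<bar>x\<bar> powr q \<le> 2 * q powr q * cosh x"
proof -
  have "\<bar>x\<bar> / q \<le> exp (\<bar>x\<bar> / q)"
    using exp_ge_add_one_self[of "\<bar>x\<bar> / q"] by linarith
  then have "\<bar>x\<bar> \<le> q * exp (\<bar>x\<bar> / q)"
    using assms by (simp add: field_simps)
  then have "\<bar>x\<bar> powr q \<le> (q * exp (\<bar>x\<bar> / q)) powr q"
    using assms by (intro powr_mono2) auto
  also have "\<dots> = q powr q * exp \<bar>x\<bar>"
    using assms by (simp add: powr_mult powr_def[of "exp _"])
  also have "\<dots> \<le> q powr q * (2 * cosh x)"
    by (intro mult_left_mono) (auto simp: cosh_def abs_if)
  finally show ?thesis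
    by (simp add: mult_ac)
qed

lemma cube_values: "\<epsilon> \<in> cube n \<Longrightarrow> j \<in> {1..n} \<Longrightarrow> \<epsilon> j = 1 \<or> \<epsilon> j = -1"
  by (auto simp: cube_def PiE_iff)

lemma sum_cube_prod:
  fixes g :: "nat \<Rightarrow> real \<Rightarrow> real"
  shows "(\<Sum>\<epsilon>\<in>cube n. \<Prod>j=1..n. g j (\<epsilon> j)) = (\<Prod>j=1..n. g j 1 + g j (- 1))"
proof -
  have "(\<Sum>\<epsilon>\<in>cube n. \<Prod>j=1..n. g j (\<epsilon> j)) = (\<Prod>j=1..n. \<Sum>x\<in>{-1, 1}. g j x)"
    unfolding cube_def by (rule prod_sum_PiE [symmetric]) auto
  then show ?thesis
    by (simp add: add.commute)
qed

definition khintchine_constant :: "real \<Rightarrow> real" where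
  "khintchine_constant q = 2 * q powr q * exp (1 / 2)"

text \<open>For coefficients of Euclidean norm 1, the moment generating function of the Rademacher sum is bounded
  at \<open>1\<close> and at \<open>- 1\<close>, because \<open>cosh x \<le> exp (x\<^sup>2 / 2)\<close> holds in each coordinate; and \<open>cosh\<close> dominates
  any power. The general case follows by homogeneity.\<close>

lemma khintchine:
  fixes a :: "nat \<Rightarrow> real"
  assumes q: "q > 0"
  shows "cube_expect n (\<lambda>\<delta>. \<bar>\<Sum>j=1..n. a j * \<delta> j\<bar> powr q)
    \<le> khintchine_constant q * (\<Sum>j=1..n. (a j)\<^sup>2) powr (q / 2)"
proof (cases "(\<Sum>j=1..n. (a j)\<^sup>2) = 0")
  case True
  then have "\<forall>j\<in>{1..n}. a j = 0"
    by (subst (asm) sum_nonneg_eq_0_iff) auto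
  then show ?thesis
    by (simp add: cube_expect_def)
next
  case False
  define \<sigma> where "\<sigma> = sqrt (\<Sum>j=1..n. (a j)\<^sup>2)"
  define b where "b j = a j / \<sigma>" for j
  have pos: "(\<Sum>j=1..n. (a j)\<^sup>2) > 0"
    using False by (simp add: less_le sum_nonneg)
  then have \<sigma>: "\<sigma> > 0" "\<sigma>\<^sup>2 = (\<Sum>j=1..n. (a j)\<^sup>2)"
    by (auto simp: \<sigma>_def)
  have b: "(\<Sum>j=1..n. (b j)\<^sup>2) = 1"
    using \<sigma> pos by (simp add: b_def power_divide flip: sum_divide_distrib)
  have laplace: "(\<Sum>\<delta>\<in>cube n. exp (c * (\<Sum>j=1..n. b j * \<delta> j))) \<le> 2 ^ n * exp (1 / 2)"
    if c: "c = 1 \<or> c = -1" for c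
  proof -
    have "(\<Sum>\<delta>\<in>cube n. exp (c * (\<Sum>j=1..n. b j * \<delta> j)))
        = (\<Sum>\<delta>\<in>cube n. \<Prod>j=1..n. exp (c * b j * \<delta> j))"
      by (simp add: exp_sum sum_distrib_left mult.assoc)
    also have "\<dots> = (\<Prod>j=1..n. exp (c * b j * 1) + exp (c * b j * - 1))"
      by (rule sum_cube_prod)
    also have "\<dots> = (\<Prod>j=1..n. 2 * cosh (b j))"
      using c by (intro prod.cong) (auto simp: cosh_def)
    also have "\<dots> \<le> (\<Prod>j=1..n. 2 * exp ((b j)\<^sup>2 / 2))"
      by (intro prod_mono) (auto intro: cosh_le_exp_half_square)
    also have "\<dots> = 2 ^ n * exp (\<Sum>j=1..n. (b j)\<^sup>2 / 2)"
      by (simp add: prod.distrib exp_sum)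
    also have "\<dots> = 2 ^ n * exp (1 / 2)"
      using b by (simp flip: sum_divide_distrib)
    finally show ?thesis .
  qed
  have "(\<Sum>\<delta>\<in>cube n. \<bar>\<Sum>j=1..n. a j * \<delta> j\<bar> powr q)
      = (\<Sum>\<delta>\<in>cube n. \<sigma> powr q * \<bar>\<Sum>j=1..n. b j * \<delta> j\<bar> powr q)"
  proof (intro sum.cong refl)
    fix \<delta> assume "\<delta> \<in> cube n"
    have "(\<Sum>j=1..n. a j * \<delta> j) = \<sigma> * (\<Sum>j=1..n. b j * \<delta> j)"
      using \<sigma> by (simp add: b_def sum_distrib_left)
    then show "\<bar>\<Sum>j=1..n. a j * \<delta> j\<bar> powr q = \<sigma> powr q * \<bar>\<Sum>j=1..n. b j * \<delta> j\<bar> powr q"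
      using \<sigma> by (simp add: abs_mult powr_mult)
  qed
  also have "\<dots> \<le> (\<Sum>\<delta>\<in>cube n. \<sigma> powr q * (2 * q powr q * cosh (\<Sum>j=1..n. b j * \<delta> j)))"
    using q by (intro sum_mono mult_left_mono abs_powr_le_cosh) auto
  also have "\<dots> = \<sigma> powr q * q powr q *
      (\<Sum>\<delta>\<in>cube n. exp (1 * (\<Sum>j=1..n. b j * \<delta> j)) + exp (- 1 * (\<Sum>j=1..n. b j * \<delta> j)))"
    unfolding sum_distrib_left[of "\<sigma> powr q * q powr q"]
    by (intro sum.cong refl) (simp add: cosh_def)
  also have "\<dots> = \<sigma> powr q * q powr q *
      ((\<Sum>\<delta>\<in>cube n. exp (1 * (\<Sum>j=1..n. b j * \<delta> j))) + (\<Sum>\<delta>\<in>cube n. exp (- 1 * (\<Sum>j=1..n. b j * \<delta> j))))"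
    by (simp only: sum.distrib)
  also have "\<dots> \<le> \<sigma> powr q * q powr q * (2 ^ n * exp (1 / 2) + 2 ^ n * exp (1 / 2))"
    by (intro mult_left_mono add_mono laplace) auto
  also have "\<dots> = 2 ^ n * (khintchine_constant q * \<sigma> powr q)"
    by (simp add: khintchine_constant_def)
  also have "\<sigma> powr q = (\<Sum>j=1..n. (a j)\<^sup>2) powr (q / 2)"
    using pos by (simp add: \<sigma>_def powr_half_sqrt[symmetric] powr_powr)
  finally show ?thesis
    by (simp add: cube_expect_def card_cube field_simps)
qed

section \<open>The Hahn-Banach theorem and maps into the bounded sequences\<close>

definition sublinear :: "('a::real_vector \<Rightarrow> real) \<Rightarrow> bool" where
  "sublinear q \<longleftrightarrow> (\<forall>x y. q (x + y) \<le> q x + q y) \<and> (\<forall>c\<ge>0. \<forall>x. q (c *\<^sub>R x) = c * q x)"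

lemma sublinear_add: "sublinear q \<Longrightarrow> q (x + y) \<le> q x + q y"
  and sublinear_scale: "sublinear q \<Longrightarrow> c \<ge> 0 \<Longrightarrow> q (c *\<^sub>R x) = c * q x"
  and sublinear_0: "sublinear q \<Longrightarrow> q 0 = 0"
proof -
  show "sublinear q \<Longrightarrow> q 0 = 0"
    unfolding sublinear_def by (metis mult_zero_left order_refl scaleR_zero_left)
qed (auto simp: sublinear_def)

lemma sublinear_minus: "sublinear q \<Longrightarrow> - q (- x) \<le> q x"
  using sublinear_add[of q x "- x"] sublinear_0[of q] by simp

lemma sublinearI:
  assumes add: "\<And>x y. q (x + y) \<le> q x + q y"
    and scale: "\<And>c x. c > 0 \<Longrightarrow> q (c *\<^sub>R x) \<le> c * q x"
  shows "sublinear q"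
  unfolding sublinear_def
proof (intro conjI allI impI add)
  fix c :: real and x assume "c \<ge> 0"
  have 0: "q 0 = 0"
    using scale[of 2 0] scale[of "1 / 2" 0] by simp
  show "q (c *\<^sub>R x) = c * q x"
  proof (cases "c = 0")
    case False
    then have c: "c > 0"
      using \<open>c \<ge> 0\<close> by simp
    have "q x \<le> (1 / c) * q (c *\<^sub>R x)"
      using scale[of "1 / c" "c *\<^sub>R x"] c by simp
    then show ?thesis
      using scale[OF c, of x] c by (simp add: field_simps)
  qed (simp add: 0)
qed

text \<open>The functional \<open>r y = inf\<^sub>t\<^sub>\<ge>\<^sub>0 (q (y + t x) - t q x)\<close> is the largest sublinear functional below \<open>q\<close>
  whose value at \<open>- x\<close> is \<open>- q x\<close>, the least value that sublinearity and \<open>r x = q x\<close> permit. So a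
  sublinear functional can be lowered strictly unless it is odd.\<close>

lemma sublinear_steepen:
  fixes q :: "'a::real_vector \<Rightarrow> real"
  assumes q: "sublinear q"
  obtains r where "sublinear r" "\<And>y. r y \<le> q y" "r (- x) \<le> - q x"
proof -
  define V where "V y = (\<lambda>t. q (y + t *\<^sub>R x) - t * q x) ` {0..}" for y
  define r where "r y = Inf (V y)" for y
  have bdd: "bdd_below (V y)" for y
    unfolding V_def
  proof (rule bdd_belowI2)
    fix t :: real assume t: "t \<in> {0..}"
    have "t * q x = q ((y + t *\<^sub>R x) + (- y))"
      using t sublinear_scale[OF q] by simp
    also have "\<dots> \<le> q (y + t *\<^sub>R x) + q (- y)"
      by (rule sublinear_add[OF q])
    finally show "- q (- y) \<le> q (y + t *\<^sub>R x) - t * q x"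
      by simp
  qed
  have r_le: "r y \<le> q (y + t *\<^sub>R x) - t * q x" if "t \<ge> 0" for y t
    unfolding r_def using that by (intro cInf_lower bdd) (auto simp: V_def)
  have r_ge: "c \<le> r y" if "\<And>t. t \<ge> 0 \<Longrightarrow> c \<le> q (y + t *\<^sub>R x) - t * q x" for c y
    unfolding r_def using that by (intro cInf_greatest) (auto simp: V_def)
  have "sublinear r"
  proof (rule sublinearI)
    fix y z
    have "r (y + z) - (q (z + t *\<^sub>R x) - t * q x) \<le> r y" if t: "t \<ge> 0" for t
    proof (rule r_ge)
      fix s :: real assume s: "s \<ge> 0"
      have "r (y + z) \<le> q ((y + s *\<^sub>R x) + (z + t *\<^sub>R x)) - (s + t) * q x"
        using r_le[of "s + t" "y + z"] s t by (simp add: algebra_simps)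
      also have "\<dots> \<le> q (y + s *\<^sub>R x) + q (z + t *\<^sub>R x) - (s + t) * q x"
        using sublinear_add[OF q] by simp
      finally show "r (y + z) - (q (z + t *\<^sub>R x) - t * q x) \<le> q (y + s *\<^sub>R x) - s * q x"
        by (simp add: algebra_simps)
    qed
    then have "r (y + z) - r y \<le> r z"
      by (intro r_ge) (simp add: algebra_simps)
    then show "r (y + z) \<le> r y + r z"
      by simp
  next
    fix c :: real and y assume c: "c > 0"
    have "r (c *\<^sub>R y) / c \<le> r y"
    proof (rule r_ge)
      fix t :: real assume t: "t \<ge> 0"
      have "r (c *\<^sub>R y) \<le> q (c *\<^sub>R (y + t *\<^sub>R x)) - (c * t) * q x"
        using r_le[of "c * t" "c *\<^sub>R y"] c t by (simp add: scaleR_add_right)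
      also have "\<dots> = c * (q (y + t *\<^sub>R x) - t * q x)"
        using c sublinear_scale[OF q, of c "y + t *\<^sub>R x"] by (simp add: right_diff_distrib)
      finally show "r (c *\<^sub>R y) / c \<le> q (y + t *\<^sub>R x) - t * q x"
        using c by (simp add: field_simps)
    qed
    then show "r (c *\<^sub>R y) \<le> c * r y"
      using c by (simp add: field_simps)
  qed
  moreover have "r y \<le> q y" for y
    using r_le[of 0 y] by simp
  moreover have "r (- x) \<le> - q x"
    using r_le[of 1 "- x"] sublinear_0[OF q] by simp
  ultimately show ?thesis
    by (rule that)
qed

text \<open>Zorn's lemma applies because the pointwise infimum of a chain is again sublinear: it is finite, since
  \<open>- p (- x)\<close> is a lower bound at \<open>x\<close>, and it is subadditive, since two members of a chain have a
  common lower bound in the chain.\<close>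

lemma minimal_sublinear_below:
  fixes p :: "'a::real_vector \<Rightarrow> real"
  assumes p: "sublinear p"
  obtains m where "sublinear m" "\<And>x. m x \<le> p x"
    "\<And>q. sublinear q \<Longrightarrow> (\<And>x. q x \<le> m x) \<Longrightarrow> q = m"
proof -
  define A where "A = {q. sublinear q \<and> (\<forall>x. q x \<le> p x)}"
  define P where "P a b \<longleftrightarrow> (\<forall>x. b x \<le> a x)" for a b :: "'a \<Rightarrow> real"
  have "\<exists>m\<in>A. \<forall>a\<in>A. P m a \<longrightarrow> a = m"
  proof (rule predicate_Zorn)
    show "partial_order_on A (relation_of P A)"
    proof (rule partial_order_on_relation_ofI)
      show "a = b" if "P a b" "P b a" for a b
        using that by (intro ext order.antisym) (auto simp: P_def)
    qed (auto simp: P_def intro: order_trans)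
  next
    fix C assume C: "C \<in> Chains (relation_of P A)"
    then have CA: "C \<subseteq> A"
      by (rule Chains_relation_of)
    have chain: "P a b \<or> P b a" if "a \<in> C" "b \<in> C" for a b
      using C that by (auto simp: Chains_def relation_of_def)
    show "\<exists>u\<in>A. \<forall>a\<in>C. P a u"
    proof (cases "C = {}")
      case True
      then show ?thesis
        using p by (auto simp: A_def)
    next
      case False
      define u where "u x = (INF a\<in>C. a x)" for x
      have bdd: "bdd_below ((\<lambda>a. a x) ` C)" for x
      proof (rule bdd_belowI2)
        fix a assume "a \<in> C"
        then have "sublinear a" "a (- x) \<le> p (- x)"
          using CA by (auto simp: A_def)
        then show "- p (- x) \<le> a x"
          using sublinear_minus[of a x] by linarith
      qed
      have u_le: "u x \<le> a x" if "a \<in> C" for a x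
        unfolding u_def using that by (intro cINF_lower bdd)
      have u_ge: "c \<le> u x" if "\<And>a. a \<in> C \<Longrightarrow> c \<le> a x" for c x
        unfolding u_def using that False by (intro cINF_greatest)
      have "sublinear u"
      proof (rule sublinearI)
        fix x y
        have "u (x + y) \<le> a x + b y" if ab: "a \<in> C" "b \<in> C" for a b
        proof -
          obtain c where c: "c \<in> C" "P a c" "P b c"
            using chain[OF ab] ab by (auto simp: P_def)
          have "u (x + y) \<le> c (x + y)"
            by (rule u_le[OF c(1)])
          also have "\<dots> \<le> c x + c y"
            using c CA by (auto simp: A_def intro: sublinear_add)
          also have "\<dots> \<le> a x + b y"
            using c by (auto simp: P_def intro: add_mono)
          finally show ?thesis .
        qed
        then have "u (x + y) - b y \<le> u x" if "b \<in> C" for b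
          using that by (intro u_ge) (simp add: algebra_simps)
        then have "u (x + y) - u x \<le> u y"
          by (intro u_ge) (simp add: algebra_simps)
        then show "u (x + y) \<le> u x + u y"
          by simp
      next
        fix c :: real and x assume c: "c > 0"
        have "u (c *\<^sub>R x) / c \<le> u x"
        proof (rule u_ge)
          fix a assume a: "a \<in> C"
          then have "a (c *\<^sub>R x) = c * a x"
            using c CA by (auto simp: A_def intro: sublinear_scale)
          then show "u (c *\<^sub>R x) / c \<le> a x"
            using u_le[OF a, of "c *\<^sub>R x"] c by (simp add: field_simps)
        qed
        then show "u (c *\<^sub>R x) \<le> c * u x"
          using c by (simp add: field_simps)
      qed
      moreover have "u x \<le> p x" for x
      proof -
        obtain a where "a \<in> C"
          using False by blast
        then show ?thesis
          using u_le[of a x] CA by (force simp: A_def intro: order_trans)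
      qed
      ultimately show ?thesis
        using u_le by (auto simp: A_def P_def)
    qed
  qed
  then obtain m where m: "m \<in> A" "\<And>a. a \<in> A \<Longrightarrow> P m a \<Longrightarrow> a = m"
    by blast
  show ?thesis
  proof (rule that)
    show "sublinear m" "m x \<le> p x" for x
      using m(1) by (auto simp: A_def)
    show "q = m" if q: "sublinear q" "\<And>x. q x \<le> m x" for q
    proof (rule m(2))
      have "q x \<le> p x" for x
        using q(2)[of x] m(1) by (auto simp: A_def intro: order_trans)
      then show "q \<in> A"
        using q(1) by (simp add: A_def)
      show "P m q"
        using q(2) by (simp add: P_def)
    qed
  qed
qed

text \<open>The norm is first lowered along \<open>x\<close>, which forces the value at \<open>- x\<close> down to \<open>- norm x\<close>; a minimal
  sublinear functional below the result cannot be lowered along any line, hence it is odd, and an odd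
  sublinear functional is linear.\<close>

theorem norming_functional:
  fixes x :: "'a::real_normed_vector"
  obtains \<phi> :: "'a \<Rightarrow> real" where "linear \<phi>" "\<phi> x = norm x" "\<And>y. \<bar>\<phi> y\<bar> \<le> norm y"
proof -
  have "sublinear (norm :: 'a \<Rightarrow> real)"
    by (auto simp: sublinear_def norm_triangle_ineq)
  then obtain r :: "'a \<Rightarrow> real" where r: "sublinear r" "\<And>y. r y \<le> norm y" "r (- x) \<le> - norm x"
    by (rule sublinear_steepen[where x = x]) blast
  obtain m where m: "sublinear m" "\<And>y. m y \<le> r y"
    and minimal: "\<And>q. sublinear q \<Longrightarrow> (\<And>y. q y \<le> m y) \<Longrightarrow> q = m"
    by (rule minimal_sublinear_below[OF r(1)]) blast
  have odd: "m (- y) = - m y" for y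
  proof -
    obtain q where "sublinear q" "\<And>z. q z \<le> m z" "q (- y) \<le> - m y"
      by (rule sublinear_steepen[OF m(1), where x = y]) blast
    then have "m (- y) \<le> - m y"
      using minimal by metis
    then show ?thesis
      using sublinear_minus[OF m(1), of y] by linarith
  qed
  have "linear m"
  proof
    fix y z
    have "m (- y + - z) \<le> m (- y) + m (- z)"
      by (rule sublinear_add[OF m(1)])
    then have "m y + m z \<le> m (y + z)"
      using odd[of "y + z"] odd[of y] odd[of z] by simp
    then show "m (y + z) = m y + m z"
      using sublinear_add[OF m(1), of y z] by simp
  next
    fix c :: real and y
    show "m (c *\<^sub>R y) = c *\<^sub>R m y"
      using sublinear_scale[OF m(1), of c y] sublinear_scale[OF m(1), of "- c" y] odd[of "c *\<^sub>R y"]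
      by (cases "c \<ge> 0") auto
  qed
  moreover have le: "m y \<le> norm y" for y
    using m(2) r(2) order_trans by blast
  moreover have "m x = norm x"
    using le[of x] m(2)[of "- x"] r(3) odd[of x] by linarith
  moreover have "\<bar>m y\<bar> \<le> norm y" for y
    using le[of y] le[of "- y"] odd[of y] by (simp add: abs_le_iff)
  ultimately show ?thesis
    by (intro that)
qed

text \<open>The coordinates of \<open>T\<close> are norming functionals of the elements of \<open>V\<close>. The vector \<open>0\<close> is added to
  \<open>V\<close> so that the enumeration \<open>e\<close> is meaningful even if \<open>V\<close> is empty.\<close>

lemma linfinity_contraction_preserving_norms:
  fixes V :: "'a::real_normed_vector set"
  assumes V: "finite V"
  obtains T :: "'a \<Rightarrow> (nat \<Rightarrow>\<^sub>C real)"
  where "linear T" "\<And>x. norm (T x) \<le> norm x" "\<And>v. v \<in> V \<Longrightarrow> norm (T v) = norm v"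
proof -
  have "\<exists>\<phi>. linear \<phi> \<and> \<phi> v = norm v \<and> (\<forall>y. \<bar>\<phi> y\<bar> \<le> norm y)" for v :: 'a
    by (rule norming_functional[of v]) blast
  then obtain \<phi> where \<phi>: "\<And>v. linear (\<phi> v)" "\<And>v. \<phi> v v = norm v"
    "\<And>v y. \<bar>\<phi> v y\<bar> \<le> norm (y :: 'a)"
    by metis
  define e where "e = from_nat_into (insert 0 V)"
  have e: "\<exists>k. e k = v" if "v \<in> V" for v
    unfolding e_def using that V
    by (meson countable_finite finite_insert from_nat_into_surj insertI2)
  define T where "T x = Bcontfun (\<lambda>k. \<phi> (e k) x)" for x
  have T: "apply_bcontfun (T x) k = \<phi> (e k) x" for x k
    unfolding T_def
    by (subst Bcontfun_inverse) (auto intro!: bcontfun_normI[where b = "norm x"] simp: \<phi>)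
  show ?thesis
  proof (rule that)
    show "linear T"
      by (intro linearI bcontfun_eqI) (auto simp: T linear_add[OF \<phi>(1)] linear_scale[OF \<phi>(1)])
    show le: "norm (T x) \<le> norm x" for x
      by (intro norm_bound) (simp add: T \<phi>)
    show "norm (T v) = norm v" if v: "v \<in> V" for v
    proof -
      obtain k where "e k = v"
        using e[OF v] by blast
      then have "norm v \<le> norm (T v)"
        using norm_bounded[of "T v" k] by (simp add: T \<phi>)
      then show ?thesis
        using le[of v] by simp
    qed
  qed
qed

section \<open>Moments under the Poisson kernel of the cube\<close>

text \<open>For \<open>r = exp (- t)\<close> this is the kernel of the heat semigroup \<open>exp (- t \<Delta>)\<close> with respect to
  counting measure. As a function of \<open>\<eta>\<close> it is the density of the point obtained from \<open>\<epsilon>\<close> by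
  flipping each coordinate independently with probability \<open>(1 - r) / 2\<close>.\<close>

definition poisson_kernel :: "nat \<Rightarrow> real \<Rightarrow> (nat \<Rightarrow> real) \<Rightarrow> (nat \<Rightarrow> real) \<Rightarrow> real" where
  "poisson_kernel n r \<epsilon> \<eta> = (\<Prod>j=1..n. (1 + r * \<epsilon> j * \<eta> j) / 2)"

lemma poisson_kernel_sym: "poisson_kernel n r \<epsilon> \<eta> = poisson_kernel n r \<eta> \<epsilon>"
  by (simp add: poisson_kernel_def mult_ac)

lemma poisson_kernel_nonneg:
  assumes "\<epsilon> \<in> cube n" "\<eta> \<in> cube n" "0 \<le> r" "r \<le> 1"
  shows "0 \<le> poisson_kernel n r \<epsilon> \<eta>"
  unfolding poisson_kernel_def
proof (rule prod_nonneg)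
  fix j assume "j \<in> {1..n}"
  then show "0 \<le> (1 + r * \<epsilon> j * \<eta> j) / 2"
    using cube_values[OF assms(1), of j] cube_values[OF assms(2), of j] assms(3,4) by auto
qed

lemma sum_poisson_kernel:
  "(\<Sum>\<eta>\<in>cube n. poisson_kernel n r \<epsilon> \<eta>) = 1"
  unfolding poisson_kernel_def
  by (subst sum_cube_prod[where g = "\<lambda>j x. (1 + r * \<epsilon> j * x) / 2"]) (simp add: field_simps)

text \<open>The coordinate \<open>\<epsilon>\<^sub>j \<eta>\<^sub>j\<close> is \<open>1\<close> with probability \<open>(1 + r) / 2\<close> and \<open>- 1\<close> otherwise. In the first
  case the deviation \<open>1 - r\<close> is small, in the second one, where it is at most \<open>2\<close>, the probability is.\<close>

lemma poisson_kernel_moment: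
  assumes \<epsilon>: "\<epsilon> \<in> cube n" and j: "j \<in> {1..n}" and r: "0 \<le> r" "r \<le> 1" and q: "q \<ge> 1"
  shows "(\<Sum>\<eta>\<in>cube n. poisson_kernel n r \<epsilon> \<eta> * \<bar>\<epsilon> j * \<eta> j - r\<bar> powr q) \<le> 2 powr q * (1 - r)"
proof -
  define g where "g i x = (1 + r * \<epsilon> i * x) / 2 * (if i = j then \<bar>\<epsilon> i * x - r\<bar> powr q else 1)"
    for i x
  have "(\<Sum>\<eta>\<in>cube n. poisson_kernel n r \<epsilon> \<eta> * \<bar>\<epsilon> j * \<eta> j - r\<bar> powr q)
      = (\<Sum>\<eta>\<in>cube n. \<Prod>i=1..n. g i (\<eta> i))"
    unfolding poisson_kernel_def g_def prod.distrib using j by simp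
  also have "\<dots> = (\<Prod>i=1..n. g i 1 + g i (- 1))"
    by (rule sum_cube_prod)
  also have "\<dots> = (\<Prod>i=1..n. if i = j then g j 1 + g j (- 1) else 1)"
    by (intro prod.cong) (auto simp: g_def field_simps)
  also have "\<dots> = g j 1 + g j (- 1)"
    using j by simp
  also have "\<dots> = (1 + r) / 2 * (1 - r) powr q + (1 - r) / 2 * (1 + r) powr q"
    using cube_values[OF \<epsilon> j] r by (auto simp: g_def add.commute)
  also have "\<dots> \<le> 1 * (1 - r) powr 1 + (1 - r) / 2 * 2 powr q"
    using r q by (intro add_mono mult_mono powr_mono2 powr_mono') auto
  also have "\<dots> = (1 + 2 powr q / 2) * (1 - r)"
    using r by (simp add: field_simps)
  also have "\<dots> \<le> 2 powr q * (1 - r)"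
  proof -
    have "(2::real) powr 1 \<le> 2 powr q"
      using q by (intro powr_mono) auto
    then show ?thesis
      using r by (intro mult_right_mono) auto
  qed
  finally show ?thesis .
qed

text \<open>Khintchine's inequality in \<open>\<delta>\<close> replaces the sum by the Euclidean norm of its coefficients. Since
  \<open>q / 2 \<ge> 1\<close>, the power mean inequality over the \<open>n\<close> coordinates then reduces to a single
  coordinate, at the cost of the factor \<open>n powr (q / 2)\<close>.\<close>

lemma gradient_field_moment:
  assumes \<epsilon>: "\<epsilon> \<in> cube n" and r: "0 \<le> r" "r \<le> 1" and q: "q \<ge> 2"
  shows "(\<Sum>\<eta>\<in>cube n. \<Sum>\<delta>\<in>cube n. poisson_kernel n r \<epsilon> \<eta> / 2 ^ n *
            \<bar>\<Sum>j=1..n. (\<epsilon> j * \<eta> j - r) * \<delta> j\<bar> powr q)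
    \<le> khintchine_constant q * 2 powr q * real n powr (q / 2) * (1 - r)"
    (is "?lhs \<le> _")
proof (cases "n = 0")
  case True
  then show ?thesis
    using q by simp
next
  case False
  define K where "K = khintchine_constant q"
  have K: "K \<ge> 0"
    by (simp add: K_def khintchine_constant_def)
  have "?lhs = (\<Sum>\<eta>\<in>cube n. poisson_kernel n r \<epsilon> \<eta> *
      cube_expect n (\<lambda>\<delta>. \<bar>\<Sum>j=1..n. (\<epsilon> j * \<eta> j - r) * \<delta> j\<bar> powr q))"
    by (simp add: cube_expect_def card_cube sum_distrib_left field_simps)
  also have "\<dots> \<le> (\<Sum>\<eta>\<in>cube n. poisson_kernel n r \<epsilon> \<eta> *
      (K * (real n powr (q / 2) * (\<Sum>j=1..n. (1 / n) * \<bar>\<epsilon> j * \<eta> j - r\<bar> powr q))))"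
  proof (intro sum_mono mult_left_mono)
    fix \<eta> assume "\<eta> \<in> cube n"
    define a where "a j = \<epsilon> j * \<eta> j - r" for j
    have "cube_expect n (\<lambda>\<delta>. \<bar>\<Sum>j=1..n. a j * \<delta> j\<bar> powr q) \<le> K * (\<Sum>j=1..n. (a j)\<^sup>2) powr (q / 2)"
      unfolding K_def using q by (intro khintchine) simp
    also have "(\<Sum>j=1..n. (a j)\<^sup>2) powr (q / 2)
        = real n powr (q / 2) * (\<Sum>j=1..n. (1 / n) * (a j)\<^sup>2) powr (q / 2)"
      using False by (simp add: powr_mult[symmetric] sum_nonneg flip: sum_distrib_left sum_divide_distrib)
    also have "\<dots> \<le> real n powr (q / 2) * (\<Sum>j=1..n. (1 / n) * ((a j)\<^sup>2) powr (q / 2))"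
      using False q by (intro mult_left_mono power_mean_sum) auto
    also have "(\<Sum>j=1..n. (1 / n) * ((a j)\<^sup>2) powr (q / 2)) = (\<Sum>j=1..n. (1 / n) * \<bar>a j\<bar> powr q)"
    proof (intro sum.cong refl)
      fix j
      have "(a j)\<^sup>2 = \<bar>a j\<bar> powr 2"
        by (cases "a j = 0") auto
      then show "1 / n * ((a j)\<^sup>2) powr (q / 2) = 1 / n * \<bar>a j\<bar> powr q"
        by (simp only: powr_powr) simp
    qed
    finally show "cube_expect n (\<lambda>\<delta>. \<bar>\<Sum>j=1..n. (\<epsilon> j * \<eta> j - r) * \<delta> j\<bar> powr q)
        \<le> K * (real n powr (q / 2) * (\<Sum>j=1..n. (1 / n) * \<bar>\<epsilon> j * \<eta> j - r\<bar> powr q))"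
      using K by (simp add: a_def mult_left_mono)
  qed (use \<epsilon> r in \<open>auto intro: poisson_kernel_nonneg\<close>)
  also have "\<dots> = K * real n powr (q / 2) * (1 / n) *
      (\<Sum>\<eta>\<in>cube n. \<Sum>j=1..n. poisson_kernel n r \<epsilon> \<eta> * \<bar>\<epsilon> j * \<eta> j - r\<bar> powr q)"
    by (simp add: sum_distrib_left mult_ac)
  also have "(\<Sum>\<eta>\<in>cube n. \<Sum>j=1..n. poisson_kernel n r \<epsilon> \<eta> * \<bar>\<epsilon> j * \<eta> j - r\<bar> powr q)
      = (\<Sum>j=1..n. \<Sum>\<eta>\<in>cube n. poisson_kernel n r \<epsilon> \<eta> * \<bar>\<epsilon> j * \<eta> j - r\<bar> powr q)"
    by (rule sum.swap)
  also have "K * real n powr (q / 2) * (1 / n) * \<dots>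
      \<le> K * real n powr (q / 2) * (1 / n) * (\<Sum>j=1..n. 2 powr q * (1 - r))"
    using \<epsilon> r q K by (intro mult_left_mono sum_mono poisson_kernel_moment) auto
  also have "\<dots> = K * 2 powr q * real n powr (q / 2) * (1 - r)"
    using False by simp
  finally show ?thesis
    by (simp add: K_def)
qed

definition gradient_constant :: "real \<Rightarrow> real" where
  "gradient_constant q = 2 * khintchine_constant (max q 2) powr (1 / max q 2)"

text \<open>For \<open>q < 2\<close> the power mean inequality would go in the wrong direction; there the \<open>q\<close>-norm is bounded
  by the 2-norm.\<close>

lemma gradient_field_norm:
  assumes \<epsilon>: "\<epsilon> \<in> cube n" and r: "0 \<le> r" "r \<le> 1" and q: "q > 1"
  shows "(\<Sum>\<eta>\<in>cube n. \<Sum>\<delta>\<in>cube n. poisson_kernel n r \<epsilon> \<eta> / 2 ^ n *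
            \<bar>\<Sum>j=1..n. (\<epsilon> j * \<eta> j - r) * \<delta> j\<bar> powr q)
    \<le> (gradient_constant q * sqrt n * (1 - r) powr (1 / max q 2)) powr q"
proof -
  define Q where "Q = max q 2"
  have Q: "Q \<ge> 2" "Q \<ge> q"
    by (auto simp: Q_def)
  define S where "S = cube n \<times> cube n"
  define w where "w = (\<lambda>(\<eta>, \<delta> :: nat \<Rightarrow> real). poisson_kernel n r \<epsilon> \<eta> / 2 ^ n)"
  define h where "h = (\<lambda>(\<eta>, \<delta>). \<bar>\<Sum>j=1..n. (\<epsilon> j * \<eta> j - r) * \<delta> j\<bar>)"
  have S: "finite S"
    by (simp add: S_def)
  have w: "w z \<ge> 0" if "z \<in> S" for z
    using that \<epsilon> r by (auto simp: w_def S_def intro!: divide_nonneg_nonneg poisson_kernel_nonneg)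
  have sum_w: "sum w S = 1"
    by (simp add: w_def S_def sum.cartesian_product[symmetric] card_cube sum_poisson_kernel)
  have eq: "(\<Sum>\<eta>\<in>cube n. \<Sum>\<delta>\<in>cube n. poisson_kernel n r \<epsilon> \<eta> / 2 ^ n *
            \<bar>\<Sum>j=1..n. (\<epsilon> j * \<eta> j - r) * \<delta> j\<bar> powr s) = (\<Sum>z\<in>S. w z * h z powr s)" for s
    by (simp add: S_def w_def h_def sum.cartesian_product case_prod_unfold)
  have h: "h z \<ge> 0" for z
    by (simp add: h_def case_prod_unfold)
  have "(\<Sum>z\<in>S. w z * h z powr q) = ((\<Sum>z\<in>S. w z * h z powr q) powr (Q / q)) powr (q / Q)"
    using q Q w by (simp add: powr_powr sum_nonneg)
  also have "\<dots> \<le> (\<Sum>z\<in>S. w z * (h z powr q) powr (Q / q)) powr (q / Q)"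
    using q Q w sum_w S by (intro powr_mono2 power_mean_sum) auto
  also have "\<dots> = (\<Sum>z\<in>S. w z * h z powr Q) powr (q / Q)"
    using q by (simp add: powr_powr)
  also have "\<dots> \<le> (khintchine_constant Q * 2 powr Q * real n powr (Q / 2) * (1 - r)) powr (q / Q)"
    using gradient_field_moment[OF \<epsilon> r Q(1)] q Q w unfolding eq
    by (intro powr_mono2) (auto intro!: sum_nonneg)
  also have "\<dots> = ((khintchine_constant Q * 2 powr Q * real n powr (Q / 2) * (1 - r)) powr (1 / Q)) powr q"
    by (simp add: powr_powr)
  also have "(khintchine_constant Q * 2 powr Q * real n powr (Q / 2) * (1 - r)) powr (1 / Q)
      = gradient_constant q * sqrt n * (1 - r) powr (1 / Q)"
    using Q r by (simp add: gradient_constant_def Q_def[symmetric] powr_mult powr_powr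
        khintchine_constant_def powr_half_sqrt)
  finally show ?thesis
    by (simp only: eq Q_def)
qed

section \<open>Integral representation of the inverse gradient\<close>

text \<open>The kernel of \<open>D\<^sub>j P\<^sub>r / r\<close> for the noise semigroup \<open>P\<^sub>r\<close>. It is polynomial in \<open>r\<close>, and its integral over
  \<open>[0, 1]\<close> is the kernel of \<open>\<Delta>\<^sup>-\<^sup>1 D\<^sub>j\<close>; the factor \<open>1 / r\<close> is the Jacobian of \<open>r = exp (- t)\<close>
  in \<open>\<Delta>\<^sup>-\<^sup>1 D\<^sub>j = \<integral>\<^sub>0\<^sup>\<infinity> exp (- t \<Delta>) D\<^sub>j dt\<close>.\<close>

definition gradient_kernel ::
  "nat \<Rightarrow> real \<Rightarrow> nat \<Rightarrow> (nat \<Rightarrow> real) \<Rightarrow> (nat \<Rightarrow> real) \<Rightarrow> real" where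
  "gradient_kernel n r j \<epsilon> \<eta> =
     (\<Sum>A | A \<subseteq> {1..n} \<and> j \<in> A. r ^ (card A - 1) * (walsh A \<epsilon> * walsh A \<eta>)) / 2 ^ n"

text \<open>The kernel of \<open>\<Delta>\<^sup>-\<^sup>1 D\<^sub>j\<close>.\<close>

definition inverse_gradient_kernel ::
  "nat \<Rightarrow> nat \<Rightarrow> (nat \<Rightarrow> real) \<Rightarrow> (nat \<Rightarrow> real) \<Rightarrow> real" where
  "inverse_gradient_kernel n j \<epsilon> \<eta> =
     (\<Sum>A | A \<subseteq> {1..n} \<and> j \<in> A. 1 / card A * (walsh A \<epsilon> * walsh A \<eta>)) / 2 ^ n"

text \<open>Put \<open>x\<^sub>i = \<epsilon>\<^sub>i \<eta>\<^sub>i\<close>. Summation over the sets that contain \<open>j\<close> gives \<open>x\<^sub>j\<close> times the product of the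
  \<open>1 + r x\<^sub>i\<close> over \<open>i \<noteq> j\<close>, and the missing factor \<open>1 + r x\<^sub>j\<close> can be restored because
  \<open>(1 - r\<^sup>2) x\<^sub>j = (x\<^sub>j - r) (1 + r x\<^sub>j)\<close> for \<open>x\<^sub>j = \<plusminus>1\<close>. Multiplying through by \<open>1 - r\<^sup>2\<close> keeps the
  identity true at \<open>r = 1\<close>.\<close>

lemma gradient_kernel_eq_poisson:
  assumes \<epsilon>: "\<epsilon> \<in> cube n" and \<eta>: "\<eta> \<in> cube n" and j: "j \<in> {1..n}"
  shows "(1 - r\<^sup>2) * gradient_kernel n r j \<epsilon> \<eta> = (\<epsilon> j * \<eta> j - r) * poisson_kernel n r \<epsilon> \<eta>"
proof -
  define J where "J = {1..n} - {j}"
  define x where "x i = \<epsilon> i * \<eta> i" for i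
  have J: "finite J" "j \<notin> J" "insert j J = {1..n}"
    using j by (auto simp: J_def)
  have sets: "{A. A \<subseteq> {1..n} \<and> j \<in> A} = insert j ` Pow J"
  proof (intro equalityI subsetI)
    fix A assume "A \<in> {A. A \<subseteq> {1..n} \<and> j \<in> A}"
    then have "A = insert j (A - {j})" "A - {j} \<in> Pow J"
      by (auto simp: J_def)
    then show "A \<in> insert j ` Pow J"
      by blast
  qed (use J in auto)
  have inj: "inj_on (insert j) (Pow J)"
    using J by (auto simp: inj_on_def)
  have "2 ^ n * gradient_kernel n r j \<epsilon> \<eta>
      = (\<Sum>A\<in>insert j ` Pow J. r ^ (card A - 1) * (walsh A \<epsilon> * walsh A \<eta>))"
    unfolding gradient_kernel_def sets by simp
  also have "\<dots> = (\<Sum>B\<in>Pow J. x j * ((\<Prod>i\<in>B. r * x i) * (\<Prod>i\<in>J-B. 1)))"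
    unfolding sum.reindex[OF inj] o_def
  proof (intro sum.cong refl)
    fix B assume "B \<in> Pow J"
    then have B: "finite B" "j \<notin> B"
      using J by (auto intro: finite_subset)
    then show "r ^ (card (insert j B) - 1) * (walsh (insert j B) \<epsilon> * walsh (insert j B) \<eta>)
        = x j * ((\<Prod>i\<in>B. r * x i) * (\<Prod>i\<in>J-B. 1))"
      by (simp add: walsh_def x_def prod.distrib)
  qed
  also have "\<dots> = x j * (\<Prod>i\<in>J. r * x i + 1)"
    unfolding prod_add[OF J(1)] by (simp add: sum_distrib_left)
  finally have *: "2 ^ n * gradient_kernel n r j \<epsilon> \<eta> = x j * (\<Prod>i\<in>J. 1 + r * x i)"
    by (simp add: add.commute)
  have "2 ^ n * poisson_kernel n r \<epsilon> \<eta> = (\<Prod>i\<in>insert j J. 1 + r * x i)"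
    by (simp add: poisson_kernel_def x_def prod_dividef mult.assoc J)
  then have **: "2 ^ n * poisson_kernel n r \<epsilon> \<eta> = (1 + r * x j) * (\<Prod>i\<in>J. 1 + r * x i)"
    by (simp only: prod.insert[OF J(1,2)])
  have "x j = 1 \<or> x j = -1"
    using cube_values[OF \<epsilon> j] cube_values[OF \<eta> j] by (auto simp: x_def)
  then have ***: "(1 - r\<^sup>2) * x j = (x j - r) * (1 + r * x j)"
    by (auto simp: power2_eq_square algebra_simps)
  have "2 ^ n * ((1 - r\<^sup>2) * gradient_kernel n r j \<epsilon> \<eta>)
      = (1 - r\<^sup>2) * (2 ^ n * gradient_kernel n r j \<epsilon> \<eta>)"
    by (rule mult.left_commute)
  also have "\<dots> = ((1 - r\<^sup>2) * x j) * (\<Prod>i\<in>J. 1 + r * x i)"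
    unfolding * by (rule mult.assoc[symmetric])
  also have "\<dots> = (x j - r) * (2 ^ n * poisson_kernel n r \<epsilon> \<eta>)"
    unfolding ** *** by (rule mult.assoc)
  also have "\<dots> = 2 ^ n * ((x j - r) * poisson_kernel n r \<epsilon> \<eta>)"
    by (rule mult.left_commute)
  finally show ?thesis
    by (simp add: x_def)
qed

lemma has_integral_gradient_kernel:
  "((\<lambda>r. gradient_kernel n r j \<epsilon> \<eta>) has_integral inverse_gradient_kernel n j \<epsilon> \<eta>) {0..1}"
  unfolding gradient_kernel_def inverse_gradient_kernel_def divide_inverse
proof (intro has_integral_mult_left has_integral_sum)
  fix A assume A: "A \<in> {A. A \<subseteq> {1..n} \<and> j \<in> A}"
  then have "finite A" "A \<noteq> {}"
    by (auto intro: finite_subset)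
  then have "card A > 0"
    by (simp add: card_gt_0_iff)
  then have "((\<lambda>r. r ^ (card A - 1)) has_integral (1 ^ card A / card A - 0 ^ card A / card A)) {0..1::real}"
    by (intro fundamental_theorem_of_calculus)
      (auto intro!: derivative_eq_intros simp flip: has_real_derivative_iff_has_vector_derivative)
  then show "((\<lambda>r. r ^ (card A - 1)) has_integral 1 * inverse (card A)) {0..1::real}"
    using \<open>card A > 0\<close> by (simp add: divide_inverse zero_power)
qed simp

lemma continuous_gradient_kernel [continuous_intros]:
  "continuous_on S (\<lambda>r. gradient_kernel n r j \<epsilon> \<eta>)"
  unfolding gradient_kernel_def by (intro continuous_intros) auto

lemma walsh_coeff_multiplier:
  fixes f :: "(nat \<Rightarrow> real) \<Rightarrow> 'a::real_vector"
  assumes B: "B \<subseteq> {1..n}"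
  shows "walsh_coeff n (walsh_multiplier n m f) B = m B *\<^sub>R walsh_coeff n f B"
proof -
  have "walsh_coeff n (walsh_multiplier n m f) B
      = (\<Sum>A\<in>Pow {1..n}. (cube_expect n (\<lambda>\<epsilon>. walsh B \<epsilon> * walsh A \<epsilon>) * m A) *\<^sub>R walsh_coeff n f A)"
    unfolding walsh_coeff_def[of n "walsh_multiplier n m f"] walsh_multiplier_def cube_expect_def
      scaleR_sum_right sum_distrib_left sum_distrib_right scaleR_sum_left
    by (subst sum.swap) (simp add: mult_ac)
  also have "\<dots> = (\<Sum>A\<in>Pow {1..n}. if A = B then m A *\<^sub>R walsh_coeff n f A else 0)"
    using B by (intro sum.cong) (auto simp: walsh_orthogonal)
  also have "\<dots> = m B *\<^sub>R walsh_coeff n f B"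
    using B by simp
  finally show ?thesis .
qed

lemma cube_Laplacian_inv_D:
  fixes f :: "(nat \<Rightarrow> real) \<Rightarrow> 'a::real_vector"
  shows "cube_Laplacian_inv n (cube_D n j f) \<epsilon> =
    (\<Sum>\<eta>\<in>cube n. inverse_gradient_kernel n j \<epsilon> \<eta> *\<^sub>R f \<eta>)"
proof -
  have "cube_Laplacian_inv n (cube_D n j f) \<epsilon>
      = (\<Sum>A\<in>Pow {1..n}. if j \<in> A then (1 / card A * walsh A \<epsilon>) *\<^sub>R walsh_coeff n f A else 0)"
    unfolding cube_Laplacian_inv_def cube_D_def
      walsh_multiplier_def[of n "\<lambda>A. if A = {} then 0 else 1 / real (card A)"]
    by (intro sum.cong) (auto simp: walsh_coeff_multiplier)
  also have "\<dots> = (\<Sum>A | A \<subseteq> {1..n} \<and> j \<in> A. (1 / card A * walsh A \<epsilon>) *\<^sub>R walsh_coeff n f A)"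
    by (simp add: sum.inter_filter[symmetric])
  also have "\<dots> = (\<Sum>A | A \<subseteq> {1..n} \<and> j \<in> A.
      \<Sum>\<eta>\<in>cube n. (1 / card A * (walsh A \<epsilon> * walsh A \<eta>) / 2 ^ n) *\<^sub>R f \<eta>)"
    by (simp add: walsh_coeff_def cube_expect_def card_cube scaleR_sum_right field_simps)
  also have "\<dots> = (\<Sum>\<eta>\<in>cube n. inverse_gradient_kernel n j \<epsilon> \<eta> *\<^sub>R f \<eta>)"
    unfolding inverse_gradient_kernel_def sum_divide_distrib scaleR_sum_left by (rule sum.swap)
  finally show ?thesis .
qed

text \<open>The averages defining the \<open>F\<^sub>j\<close> are taken over the same \<open>\<delta>\<close>, so the sum over \<open>j\<close> becomes a
  single average of \<open>F\<close> against a scalar weight.\<close>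

lemma sum_cube_Laplacian_inv_D_proj:
  fixes F :: "(nat \<Rightarrow> real) \<Rightarrow> (nat \<Rightarrow> real) \<Rightarrow> 'a::real_vector"
  shows "(\<Sum>j=1..n. cube_Laplacian_inv n (cube_D n j (cube_proj n j F)) \<epsilon>) =
    (\<Sum>\<eta>\<in>cube n. \<Sum>\<delta>\<in>cube n.
       ((\<Sum>j=1..n. inverse_gradient_kernel n j \<epsilon> \<eta> * \<delta> j) / 2 ^ n) *\<^sub>R F \<eta> \<delta>)"
proof -
  have "(\<Sum>j=1..n. cube_Laplacian_inv n (cube_D n j (cube_proj n j F)) \<epsilon>) =
    (\<Sum>j=1..n. \<Sum>\<eta>\<in>cube n. \<Sum>\<delta>\<in>cube n. (inverse_gradient_kernel n j \<epsilon> \<eta> * \<delta> j / 2 ^ n) *\<^sub>R F \<eta> \<delta>)"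
    by (simp add: cube_Laplacian_inv_D cube_proj_def cube_expect_def card_cube scaleR_sum_right
        field_simps)
  also have "\<dots> = (\<Sum>\<eta>\<in>cube n. \<Sum>j=1..n. \<Sum>\<delta>\<in>cube n.
      (inverse_gradient_kernel n j \<epsilon> \<eta> * \<delta> j / 2 ^ n) *\<^sub>R F \<eta> \<delta>)"
    by (rule sum.swap)
  also have "\<dots> = (\<Sum>\<eta>\<in>cube n. \<Sum>\<delta>\<in>cube n. \<Sum>j=1..n.
      (inverse_gradient_kernel n j \<epsilon> \<eta> * \<delta> j / 2 ^ n) *\<^sub>R F \<eta> \<delta>)"
    by (intro sum.cong refl sum.swap)
  finally show ?thesis
    by (simp add: sum_divide_distrib scaleR_sum_left)
qed

section \<open>The inequality in an arbitrary normed space\<close>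

text \<open>The functions \<open>\<phi>\<close> and \<open>f\<close> stand for the dual function and for the norm of \<open>F\<close>. Hoelder's inequality
  is applied on triples \<open>(\<epsilon>, \<eta>, \<delta>)\<close> weighted by the Poisson kernel. The factor
  \<open>\<phi> \<epsilon> |h|\<close> is integrated first in \<open>(\<eta>, \<delta>)\<close>, the factor \<open>f\<close> first in \<open>\<epsilon>\<close>: the symmetric Poisson kernel
  is a probability density in either variable.\<close>

lemma gradient_field_holder:
  fixes \<phi> :: "(nat \<Rightarrow> real) \<Rightarrow> real" and f :: "(nat \<Rightarrow> real) \<Rightarrow> (nat \<Rightarrow> real) \<Rightarrow> real"
  assumes pq: "p > 1" "q > 1" "1 / p + 1 / q = 1" and r: "0 \<le> r" "r < 1"
    and \<phi>: "\<And>\<epsilon>. 0 \<le> \<phi> \<epsilon>" and f: "\<And>\<eta> \<delta>. 0 \<le> f \<eta> \<delta>"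
  shows "(\<Sum>\<epsilon>\<in>cube n. \<Sum>\<eta>\<in>cube n. \<Sum>\<delta>\<in>cube n.
            \<phi> \<epsilon> * f \<eta> \<delta> * \<bar>\<Sum>j=1..n. gradient_kernel n r j \<epsilon> \<eta> * \<delta> j\<bar>)
    \<le> (2 ^ n) powr (1 / q) * gradient_constant q * sqrt n * (\<Sum>\<epsilon>\<in>cube n. \<phi> \<epsilon> powr q) powr (1 / q) *
       (\<Sum>\<eta>\<in>cube n. \<Sum>\<delta>\<in>cube n. f \<eta> \<delta> powr p) powr (1 / p) * (1 - r) powr (1 / max q 2 - 1)"
    (is "?lhs \<le> _")
proof -
  define T where "T = cube n \<times> cube n \<times> cube n"
  define P where "P = (\<lambda>(\<epsilon>, \<eta>, \<delta> :: nat \<Rightarrow> real). poisson_kernel n r \<epsilon> \<eta>)"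
  define h where "h \<epsilon> \<eta> \<delta> = \<bar>\<Sum>j=1..n. (\<epsilon> j * \<eta> j - r) * \<delta> j\<bar>" for \<epsilon> \<eta> \<delta> :: "nat \<Rightarrow> real"
  define a where "a = (\<lambda>(\<epsilon>, \<eta>, \<delta>). \<phi> \<epsilon> * h \<epsilon> \<eta> \<delta>)"
  define b where "b = (\<lambda>(\<epsilon> :: nat \<Rightarrow> real, \<eta>, \<delta>). f \<eta> \<delta>)"
  define M where "M = gradient_constant q * sqrt n * (1 - r) powr (1 / max q 2)"
  define \<Phi> where "\<Phi> = (\<Sum>\<epsilon>\<in>cube n. \<phi> \<epsilon> powr q)"
  define N where "N = (\<Sum>\<eta>\<in>cube n. \<Sum>\<delta>\<in>cube n. f \<eta> \<delta> powr p)"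
  have [simp]: "h \<epsilon> \<eta> \<delta> \<ge> 0" for \<epsilon> \<eta> \<delta>
    by (simp add: h_def)
  have M: "M \<ge> 0"
    by (simp add: M_def gradient_constant_def)
  have \<Phi>: "\<Phi> \<ge> 0"
    by (simp add: \<Phi>_def sum_nonneg)
  have P: "P z \<ge> 0" if "z \<in> T" for z
    using that r by (auto simp: P_def T_def intro!: poisson_kernel_nonneg)
  have sum_T: "(\<Sum>z\<in>T. g z) = (\<Sum>\<epsilon>\<in>cube n. \<Sum>\<eta>\<in>cube n. \<Sum>\<delta>\<in>cube n. g (\<epsilon>, \<eta>, \<delta>))"
    for g :: "_ \<Rightarrow> real"
    by (simp add: T_def sum.cartesian_product)
  have kernel: "\<bar>\<Sum>j=1..n. gradient_kernel n r j \<epsilon> \<eta> * \<delta> j\<bar>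
      \<le> poisson_kernel n r \<epsilon> \<eta> * h \<epsilon> \<eta> \<delta> / (1 - r)"
    if "\<epsilon> \<in> cube n" "\<eta> \<in> cube n" for \<epsilon> \<eta> \<delta>
  proof -
    have "(1 - r\<^sup>2) * (\<Sum>j=1..n. gradient_kernel n r j \<epsilon> \<eta> * \<delta> j)
        = (\<Sum>j=1..n. ((1 - r\<^sup>2) * gradient_kernel n r j \<epsilon> \<eta>) * \<delta> j)"
      by (simp add: sum_distrib_left mult_ac)
    also have "\<dots> = (\<Sum>j=1..n. ((\<epsilon> j * \<eta> j - r) * poisson_kernel n r \<epsilon> \<eta>) * \<delta> j)"
      using that by (intro sum.cong refl) (simp only: gradient_kernel_eq_poisson)
    also have "\<dots> = poisson_kernel n r \<epsilon> \<eta> * (\<Sum>j=1..n. (\<epsilon> j * \<eta> j - r) * \<delta> j)"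
      by (simp add: sum_distrib_left mult_ac)
    finally have "\<bar>1 - r\<^sup>2\<bar> * \<bar>\<Sum>j=1..n. gradient_kernel n r j \<epsilon> \<eta> * \<delta> j\<bar>
        = \<bar>poisson_kernel n r \<epsilon> \<eta>\<bar> * h \<epsilon> \<eta> \<delta>"
      unfolding h_def abs_mult[symmetric] by (rule arg_cong)
    moreover have "r\<^sup>2 \<le> 1"
      using r by (simp add: power_le_one)
    ultimately have eq: "(1 - r\<^sup>2) * \<bar>\<Sum>j=1..n. gradient_kernel n r j \<epsilon> \<eta> * \<delta> j\<bar>
        = poisson_kernel n r \<epsilon> \<eta> * h \<epsilon> \<eta> \<delta>"
      using poisson_kernel_nonneg[OF that, of r] r
      by simp
    have "1 - r \<le> 1 - r\<^sup>2"
      using r by (simp add: power2_eq_square mult_left_le)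
    then have "(1 - r) * \<bar>\<Sum>j=1..n. gradient_kernel n r j \<epsilon> \<eta> * \<delta> j\<bar>
        \<le> poisson_kernel n r \<epsilon> \<eta> * h \<epsilon> \<eta> \<delta>"
      unfolding eq[symmetric] by (intro mult_right_mono) auto
    then show ?thesis
      using r by (simp add: field_simps)
  qed
  have sum_a: "(\<Sum>z\<in>T. P z * a z powr q) \<le> 2 ^ n * M powr q * \<Phi>"
  proof -
    have "(\<Sum>z\<in>T. P z * a z powr q) = (\<Sum>\<epsilon>\<in>cube n. 2 ^ n * \<phi> \<epsilon> powr q *
        (\<Sum>\<eta>\<in>cube n. \<Sum>\<delta>\<in>cube n. poisson_kernel n r \<epsilon> \<eta> / 2 ^ n * h \<epsilon> \<eta> \<delta> powr q))"
      using \<phi> by (simp add: sum_T P_def a_def powr_mult sum_distrib_left mult_ac)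
    also have "\<dots> \<le> (\<Sum>\<epsilon>\<in>cube n. 2 ^ n * \<phi> \<epsilon> powr q * M powr q)"
      unfolding h_def M_def using r pq by (intro sum_mono mult_left_mono gradient_field_norm) auto
    finally show ?thesis
      by (simp add: \<Phi>_def sum_distrib_left mult_ac)
  qed
  have sum_b: "(\<Sum>z\<in>T. P z * b z powr p) = N"
  proof -
    have "(\<Sum>z\<in>T. P z * b z powr p)
        = (\<Sum>\<eta>\<in>cube n. \<Sum>\<epsilon>\<in>cube n. \<Sum>\<delta>\<in>cube n. poisson_kernel n r \<epsilon> \<eta> * f \<eta> \<delta> powr p)"
      unfolding sum_T P_def b_def prod.case by (rule sum.swap)
    also have "\<dots> = (\<Sum>\<eta>\<in>cube n. (\<Sum>\<epsilon>\<in>cube n. poisson_kernel n r \<eta> \<epsilon>) * (\<Sum>\<delta>\<in>cube n. f \<eta> \<delta> powr p))"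
      unfolding sum_distrib_right by (simp add: sum_distrib_left poisson_kernel_sym[of n r])
    finally show ?thesis
      by (simp add: sum_poisson_kernel N_def)
  qed
  have "?lhs \<le> (\<Sum>\<epsilon>\<in>cube n. \<Sum>\<eta>\<in>cube n. \<Sum>\<delta>\<in>cube n.
      \<phi> \<epsilon> * f \<eta> \<delta> * (poisson_kernel n r \<epsilon> \<eta> * h \<epsilon> \<eta> \<delta> / (1 - r)))"
    using \<phi> f by (intro sum_mono mult_left_mono kernel) auto
  also have "\<dots> = (\<Sum>z\<in>T. P z * (a z * b z)) / (1 - r)"
    by (simp add: sum_T P_def a_def b_def sum_divide_distrib mult_ac)
  also have "\<dots> \<le> (\<Sum>z\<in>T. P z * a z powr q) powr (1 / q) *
      (\<Sum>z\<in>T. P z * b z powr p) powr (1 / p) / (1 - r)"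
    using r pq P \<phi> f
    by (intro divide_right_mono holder_sum) (auto simp: a_def b_def T_def add.commute)
  also have "\<dots> \<le> (2 ^ n * M powr q * \<Phi>) powr (1 / q) * N powr (1 / p) / (1 - r)"
    unfolding sum_b using r pq P
    by (intro divide_right_mono mult_right_mono powr_mono2 sum_a) (auto intro!: sum_nonneg)
  also have "(2 ^ n * M powr q * \<Phi>) powr (1 / q) = (2 ^ n) powr (1 / q) * M * \<Phi> powr (1 / q)"
    using M \<Phi> pq by (simp add: powr_mult powr_powr)
  also have "(2 ^ n) powr (1 / q) * M * \<Phi> powr (1 / q) * N powr (1 / p) / (1 - r)
     = (2 ^ n) powr (1 / q) * gradient_constant q * sqrt n * \<Phi> powr (1 / q) *
       N powr (1 / p) * (1 - r) powr (1 / max q 2 - 1)"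
    using r by (simp add: M_def powr_diff)
  finally show ?thesis
    by (simp add: \<Phi>_def N_def)
qed

lemma has_integral_one_minus_powr:
  assumes "s > 0"
  shows "((\<lambda>r. (1 - r) powr (s - 1)) has_integral 1 / s) {0..1::real}"
proof -
  have "((\<lambda>r. (1 - r) powr (s - 1)) has_integral (- ((1 - 1) powr s) / s - - ((1 - 0) powr s) / s)) {0..1::real}"
  proof (rule fundamental_theorem_of_calculus_interior)
    show "continuous_on {0..1::real} (\<lambda>r. - ((1 - r) powr s) / s)"
      using assms by (intro continuous_intros continuous_on_powr') auto
    show "((\<lambda>r. - ((1 - r) powr s) / s) has_vector_derivative (1 - r) powr (s - 1)) (at r)"
      if "r \<in> {0<..<1}" for r :: real
      unfolding has_real_derivative_iff_has_vector_derivative[symmetric]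
      using that assms by (auto intro!: derivative_eq_intros)
  qed simp
  then show ?thesis
    by simp
qed

text \<open>The preceding estimate is integrated over \<open>r\<close>. Pairing with \<open>\<phi>\<close> before integrating turns the
  \<open>p\<close>-norm of an integral over \<open>r\<close> into the integral of a real function of \<open>r\<close>.\<close>

lemma inverse_gradient_duality:
  fixes \<phi> :: "(nat \<Rightarrow> real) \<Rightarrow> real" and f :: "(nat \<Rightarrow> real) \<Rightarrow> (nat \<Rightarrow> real) \<Rightarrow> real"
  assumes pq: "p > 1" "q > 1" "1 / p + 1 / q = 1"
    and \<phi>: "\<And>\<epsilon>. 0 \<le> \<phi> \<epsilon>" and f: "\<And>\<eta> \<delta>. 0 \<le> f \<eta> \<delta>"
  shows "(\<Sum>\<epsilon>\<in>cube n. \<Sum>\<eta>\<in>cube n. \<Sum>\<delta>\<in>cube n.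
            \<phi> \<epsilon> * f \<eta> \<delta> * \<bar>\<Sum>j=1..n. inverse_gradient_kernel n j \<epsilon> \<eta> * \<delta> j\<bar>)
    \<le> (2 ^ n) powr (1 / q) * (max q 2 * gradient_constant q) * sqrt n *
       (\<Sum>\<epsilon>\<in>cube n. \<phi> \<epsilon> powr q) powr (1 / q) *
       (\<Sum>\<eta>\<in>cube n. \<Sum>\<delta>\<in>cube n. f \<eta> \<delta> powr p) powr (1 / p)"
    (is "?lhs \<le> _")
proof -
  define G where "G r \<epsilon> \<eta> \<delta> = (\<Sum>j=1..n. gradient_kernel n r j \<epsilon> \<eta> * \<delta> j)"
    for r and \<epsilon> \<eta> \<delta> :: "nat \<Rightarrow> real"
  define I where "I \<epsilon> \<eta> \<delta> = integral {0..1} (\<lambda>r. \<bar>G r \<epsilon> \<eta> \<delta>\<bar>)" for \<epsilon> \<eta> \<delta>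
  define \<Psi> where "\<Psi> r = (\<Sum>\<epsilon>\<in>cube n. \<Sum>\<eta>\<in>cube n. \<Sum>\<delta>\<in>cube n. \<phi> \<epsilon> * f \<eta> \<delta> * \<bar>G r \<epsilon> \<eta> \<delta>\<bar>)"
    for r
  define D where "D = (2 ^ n) powr (1 / q) * gradient_constant q * sqrt n *
       (\<Sum>\<epsilon>\<in>cube n. \<phi> \<epsilon> powr q) powr (1 / q) *
       (\<Sum>\<eta>\<in>cube n. \<Sum>\<delta>\<in>cube n. f \<eta> \<delta> powr p) powr (1 / p)"
  have I: "((\<lambda>r. \<bar>G r \<epsilon> \<eta> \<delta>\<bar>) has_integral I \<epsilon> \<eta> \<delta>) {0..1}" for \<epsilon> \<eta> \<delta>
    unfolding I_def G_def by (intro integrable_integral integrable_continuous_real continuous_intros)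
  have kernel_le: "\<bar>\<Sum>j=1..n. inverse_gradient_kernel n j \<epsilon> \<eta> * \<delta> j\<bar> \<le> I \<epsilon> \<eta> \<delta>" for \<epsilon> \<eta> \<delta>
  proof -
    have G: "((\<lambda>r. G r \<epsilon> \<eta> \<delta>) has_integral (\<Sum>j=1..n. inverse_gradient_kernel n j \<epsilon> \<eta> * \<delta> j)) {0..1}"
      unfolding G_def by (intro has_integral_sum has_integral_mult_left has_integral_gradient_kernel) simp
    have "(\<Sum>j=1..n. inverse_gradient_kernel n j \<epsilon> \<eta> * \<delta> j) \<le> I \<epsilon> \<eta> \<delta>"
      by (rule has_integral_le[OF G I]) simp
    moreover have "- (\<Sum>j=1..n. inverse_gradient_kernel n j \<epsilon> \<eta> * \<delta> j) \<le> I \<epsilon> \<eta> \<delta>"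
      by (rule has_integral_le[OF has_integral_neg[OF G] I]) simp
    ultimately show ?thesis
      by simp
  qed
  have \<Psi>: "(\<Psi> has_integral (\<Sum>\<epsilon>\<in>cube n. \<Sum>\<eta>\<in>cube n. \<Sum>\<delta>\<in>cube n. \<phi> \<epsilon> * f \<eta> \<delta> * I \<epsilon> \<eta> \<delta>)) {0..1}"
    unfolding \<Psi>_def by (intro has_integral_sum has_integral_mult_right I finite_cube)
  have weight: "((\<lambda>r. D * (1 - r) powr (1 / max q 2 - 1)) has_integral (D * (1 / (1 / max q 2)))) {0..1}"
    using pq by (intro has_integral_mult_right has_integral_one_minus_powr) auto
  have "?lhs \<le> (\<Sum>\<epsilon>\<in>cube n. \<Sum>\<eta>\<in>cube n. \<Sum>\<delta>\<in>cube n. \<phi> \<epsilon> * f \<eta> \<delta> * I \<epsilon> \<eta> \<delta>)"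
    using \<phi> f by (intro sum_mono mult_left_mono kernel_le) auto
  also have "\<dots> \<le> D * (1 / (1 / max q 2))"
  proof (rule has_integral_le)
    \<comment> \<open>The estimate can fail at \<open>r = 1\<close>, where \<open>0 powr (1 / max q 2 - 1) = 0\<close>; hence the open interval.\<close>
    show "(\<Psi> has_integral (\<Sum>\<epsilon>\<in>cube n. \<Sum>\<eta>\<in>cube n. \<Sum>\<delta>\<in>cube n. \<phi> \<epsilon> * f \<eta> \<delta> * I \<epsilon> \<eta> \<delta>)) {0<..<1}"
      using \<Psi> by (simp add: has_integral_Icc_iff_Ioo)
    show "((\<lambda>r. D * (1 - r) powr (1 / max q 2 - 1)) has_integral (D * (1 / (1 / max q 2)))) {0<..<1}"
      using weight by (simp only: has_integral_Icc_iff_Ioo)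
    show "\<Psi> r \<le> D * (1 - r) powr (1 / max q 2 - 1)" if "r \<in> {0<..<1}" for r
      unfolding \<Psi>_def D_def G_def using that pq \<phi> f by (intro gradient_field_holder) auto
  qed
  finally show ?thesis
    by (simp add: D_def mult_ac)
qed

text \<open>The extremal dual function is \<open>L powr (p - 1)\<close>: its \<open>q\<close>-th power is \<open>L powr p\<close>, so the sum of
  \<open>L powr p\<close> is bounded by a multiple of its own power with exponent \<open>1 / q\<close>, which can be cancelled.\<close>

lemma cube_inequality_with_constant:
  fixes F :: "(nat \<Rightarrow> real) \<Rightarrow> (nat \<Rightarrow> real) \<Rightarrow> 'a::real_normed_vector"
  assumes pq: "p > 1" "q > 1" "1 / p + 1 / q = 1"
  shows "cube_expect n (\<lambda>\<epsilon>.
           norm (\<Sum>j=1..n. cube_Laplacian_inv n (cube_D n j (cube_proj n j F)) \<epsilon>) powr p) powr (1 / p)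
         \<le> max q 2 * gradient_constant q * sqrt n *
           cube_expect n (\<lambda>\<epsilon>. cube_expect n (\<lambda>\<delta>. norm (F \<epsilon> \<delta>) powr p)) powr (1 / p)"
proof -
  define L where "L \<epsilon> = norm (\<Sum>j=1..n. cube_Laplacian_inv n (cube_D n j (cube_proj n j F)) \<epsilon>)" for \<epsilon>
  define S where "S = (\<Sum>\<epsilon>\<in>cube n. L \<epsilon> powr p)"
  define N where "N = (\<Sum>\<eta>\<in>cube n. \<Sum>\<delta>\<in>cube n. norm (F \<eta> \<delta>) powr p)"
  define C where "C = max q 2 * gradient_constant q * sqrt n"
  have [simp]: "L \<epsilon> \<ge> 0" for \<epsilon>
    by (simp add: L_def)
  have C: "C \<ge> 0"
    using pq by (simp add: C_def gradient_constant_def)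
  have S: "S \<ge> 0"
    by (simp add: S_def sum_nonneg)
  have L_le: "2 ^ n * L \<epsilon> \<le> (\<Sum>\<eta>\<in>cube n. \<Sum>\<delta>\<in>cube n.
      norm (F \<eta> \<delta>) * \<bar>\<Sum>j=1..n. inverse_gradient_kernel n j \<epsilon> \<eta> * \<delta> j\<bar>)" for \<epsilon>
  proof -
    have "L \<epsilon> \<le> (\<Sum>\<eta>\<in>cube n. \<Sum>\<delta>\<in>cube n.
        norm (((\<Sum>j=1..n. inverse_gradient_kernel n j \<epsilon> \<eta> * \<delta> j) / 2 ^ n) *\<^sub>R F \<eta> \<delta>))"
      unfolding L_def sum_cube_Laplacian_inv_D_proj by (intro sum_norm_le norm_sum)
    also have "\<dots> = (\<Sum>\<eta>\<in>cube n. \<Sum>\<delta>\<in>cube n.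
        norm (F \<eta> \<delta>) * \<bar>\<Sum>j=1..n. inverse_gradient_kernel n j \<epsilon> \<eta> * \<delta> j\<bar>) / 2 ^ n"
      by (simp add: sum_divide_distrib[of _ "cube n"] mult.commute)
    finally show ?thesis
      by (simp add: field_simps)
  qed
  have "(p - 1) * q = p"
    using pq by (simp add: field_simps)
  then have conj: "(L \<epsilon> powr (p - 1)) powr q = L \<epsilon> powr p" for \<epsilon>
    by (simp only: powr_powr)
  have "2 ^ n * S = (\<Sum>\<epsilon>\<in>cube n. L \<epsilon> powr (p - 1) * (2 ^ n * L \<epsilon>))"
  proof -
    have "L \<epsilon> powr (p - 1) * L \<epsilon> = L \<epsilon> powr p" for \<epsilon>
      by (cases "L \<epsilon> = 0") (auto simp: powr_diff)
    then have eq: "L \<epsilon> powr (p - 1) * (2 ^ n * L \<epsilon>) = 2 ^ n * L \<epsilon> powr p" for \<epsilon>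
      by (metis mult.left_commute)
    show ?thesis
      by (simp only: S_def sum_distrib_left eq)
  qed
  also have "\<dots> \<le> (\<Sum>\<epsilon>\<in>cube n. L \<epsilon> powr (p - 1) * (\<Sum>\<eta>\<in>cube n. \<Sum>\<delta>\<in>cube n.
      norm (F \<eta> \<delta>) * \<bar>\<Sum>j=1..n. inverse_gradient_kernel n j \<epsilon> \<eta> * \<delta> j\<bar>))"
    by (intro sum_mono mult_left_mono L_le) auto
  also have "\<dots> = (\<Sum>\<epsilon>\<in>cube n. \<Sum>\<eta>\<in>cube n. \<Sum>\<delta>\<in>cube n. L \<epsilon> powr (p - 1) *
      norm (F \<eta> \<delta>) * \<bar>\<Sum>j=1..n. inverse_gradient_kernel n j \<epsilon> \<eta> * \<delta> j\<bar>)"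
    by (simp add: sum_distrib_left mult.assoc)
  also have "\<dots> \<le> (2 ^ n) powr (1 / q) * (max q 2 * gradient_constant q) * sqrt n *
       (\<Sum>\<epsilon>\<in>cube n. (L \<epsilon> powr (p - 1)) powr q) powr (1 / q) * N powr (1 / p)"
    unfolding N_def using pq by (intro inverse_gradient_duality) auto
  also have "\<dots> = C * (2 ^ n * S) powr (1 / q) * N powr (1 / p)"
    using S by (simp add: conj S_def[symmetric] C_def powr_mult mult_ac)
  finally have main: "2 ^ n * S \<le> C * (2 ^ n * S) powr (1 / q) * N powr (1 / p)" .
  have "(2 ^ n * S) powr (1 / p) \<le> C * N powr (1 / p)"
  proof (cases "S = 0")
    case True
    then show ?thesis
      using C by simp
  next
    case False
    then have pos: "2 ^ n * S > 0"
      using S by simp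
    have "(2 ^ n * S) powr (1 / p) * (2 ^ n * S) powr (1 / q) = 2 ^ n * S"
      using pos pq by (simp flip: powr_add)
    then have "(2 ^ n * S) powr (1 / p) * (2 ^ n * S) powr (1 / q)
        \<le> (C * N powr (1 / p)) * (2 ^ n * S) powr (1 / q)"
      using main by (simp add: mult_ac)
    then show ?thesis
      by (rule mult_right_le_imp_le) (use False S in simp)
  qed
  then have "(2 ^ n * S) powr (1 / p) / (2 ^ n * 2 ^ n) powr (1 / p)
      \<le> C * N powr (1 / p) / (2 ^ n * 2 ^ n) powr (1 / p)"
    by (intro divide_right_mono) auto
  then have "(2 ^ n * S / (2 ^ n * 2 ^ n)) powr (1 / p) \<le> C * (N / (2 ^ n * 2 ^ n)) powr (1 / p)"
    by (simp only: powr_divide times_divide_eq_right)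
  moreover have "cube_expect n (\<lambda>\<epsilon>. L \<epsilon> powr p) = 2 ^ n * S / (2 ^ n * 2 ^ n)"
    by (simp add: cube_expect_def card_cube S_def field_simps)
  moreover have "cube_expect n (\<lambda>\<epsilon>. cube_expect n (\<lambda>\<delta>. norm (F \<epsilon> \<delta>) powr p)) = N / (2 ^ n * 2 ^ n)"
    by (simp add: cube_expect_def card_cube N_def sum_distrib_left sum_divide_distrib field_simps)
  ultimately show ?thesis
    by (simp add: L_def C_def)
qed

section \<open>The optimal constant\<close>

text \<open>For fixed \<open>n\<close> and \<open>F\<close> the inequality is closed in the constant, so it passes to the infimum of the
  admissible constants, which exist by the previous section.\<close>

lemma
  fixes F :: "(nat \<Rightarrow> real) \<Rightarrow> (nat \<Rightarrow> real) \<Rightarrow> (nat \<Rightarrow>\<^sub>C real)"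
  assumes p: "1 < p" "p' = p / (p - 1)" and n: "n \<ge> 1"
  shows optimal_constant_nonneg: "0 \<le> optimal_constant p'"
    and optimal_constant_linfinity: "cube_expect n (\<lambda>\<epsilon>.
           norm (\<Sum>j=1..n. cube_Laplacian_inv n (cube_D n j (cube_proj n j F)) \<epsilon>) powr p) powr (1 / p)
         \<le> optimal_constant p' * sqrt n *
           cube_expect n (\<lambda>\<epsilon>. cube_expect n (\<lambda>\<delta>. norm (F \<epsilon> \<delta>) powr p)) powr (1 / p)"
      (is ?inequality)
proof -
  have p': "p' / (p' - 1) = p" "p' > 1" "1 / p + 1 / p' = 1"
  proof -
    have "p' - 1 = 1 / (p - 1)" and inv: "1 / p' = (p - 1) / p"
      using p(1) by (simp_all add: p(2) field_simps)
    then show "p' / (p' - 1) = p"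
      using p by simp
    have "p' - 1 > 0"
      using \<open>p' - 1 = 1 / (p - 1)\<close> p(1) by simp
    then show "p' > 1"
      by simp
    show "1 / p + 1 / p' = 1"
      unfolding inv using p(1) by (simp add: field_simps)
  qed
  define lhs where "lhs n F = cube_expect n (\<lambda>\<epsilon>.
      norm (\<Sum>j=1..n. cube_Laplacian_inv n (cube_D n j (cube_proj n j F)) \<epsilon>) powr p) powr (1 / p)"
    for n and F :: "(nat \<Rightarrow> real) \<Rightarrow> (nat \<Rightarrow> real) \<Rightarrow> (nat \<Rightarrow>\<^sub>C real)"
  define rhs where "rhs n F = cube_expect n (\<lambda>\<epsilon>. cube_expect n (\<lambda>\<delta>. norm (F \<epsilon> \<delta>) powr p)) powr (1 / p)"
    for n and F :: "(nat \<Rightarrow> real) \<Rightarrow> (nat \<Rightarrow> real) \<Rightarrow> (nat \<Rightarrow>\<^sub>C real)"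
  define K where "K = {C. 0 \<le> C \<and> (\<forall>n\<ge>1. \<forall>F. lhs n F \<le> C * sqrt (real n) * rhs n F)}"
  have opt: "optimal_constant p' = Inf K"
    by (simp add: optimal_constant_def p' K_def lhs_def rhs_def)
  have "max p' 2 * gradient_constant p' \<in> K"
    unfolding K_def lhs_def rhs_def
    using cube_inequality_with_constant[OF p(1) p'(2,3), where 'a = "nat \<Rightarrow>\<^sub>C real"] p'
    by (auto simp: gradient_constant_def)
  then have K: "K \<noteq> {}"
    by blast
  show "0 \<le> optimal_constant p'"
    unfolding opt using K by (intro cInf_greatest) (auto simp: K_def)
  have "lhs n F \<le> Inf K * (sqrt n * rhs n F)"
  proof (cases "rhs n F = 0")
    case True
    obtain C where "C \<in> K"
      using K by blast
    then have "lhs n F \<le> C * sqrt (real n) * rhs n F"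
      using n by (simp add: K_def)
    then show ?thesis
      using True by simp
  next
    case False
    then have "sqrt n * rhs n F > 0"
      using n by (simp add: rhs_def zero_less_mult_iff)
    moreover have "lhs n F / (sqrt n * rhs n F) \<le> Inf K"
    proof (rule cInf_greatest[OF K])
      fix C assume "C \<in> K"
      then have "lhs n F \<le> C * (sqrt (real n) * rhs n F)"
        using n by (simp add: K_def mult.assoc)
      then show "lhs n F / (sqrt n * rhs n F) \<le> C"
        using \<open>sqrt n * rhs n F > 0\<close> by (simp add: pos_divide_le_eq)
    qed
    ultimately show ?thesis
      by (simp add: pos_divide_le_eq)
  qed
  then show ?inequality
    by (simp add: opt lhs_def rhs_def mult.assoc)
qed

text \<open>The map into \<open>l\<^sup>\<infinity>\<close> need only preserve the norms of the finitely many values of the left-hand side.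
  Norms of \<open>F\<close> may decrease, since they occur only on the larger side and the optimal constant is
  nonnegative.\<close>

theorem corollary3p3:
  fixes p p' :: real and n :: nat
    and F :: "(nat \<Rightarrow> real) \<Rightarrow> (nat \<Rightarrow> real) \<Rightarrow> 'a::banach"
  assumes "1 < p" and "p' = p / (p - 1)" and "n \<ge> 1"
  shows "cube_expect n (\<lambda>\<epsilon>.
           norm (\<Sum>j=1..n. cube_Laplacian_inv n (cube_D n j (cube_proj n j F)) \<epsilon>) powr p) powr (1 / p)
         \<le> optimal_constant p' * sqrt (real n) *
           cube_expect n (\<lambda>\<epsilon>. cube_expect n (\<lambda>\<delta>. norm (F \<epsilon> \<delta>) powr p)) powr (1 / p)"
proof -
  define L where "L \<epsilon> = (\<Sum>j=1..n. cube_Laplacian_inv n (cube_D n j (cube_proj n j F)) \<epsilon>)" for \<epsilon>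
  obtain T :: "'a \<Rightarrow> (nat \<Rightarrow>\<^sub>C real)"
    where T: "linear T" "\<And>x. norm (T x) \<le> norm x" "\<And>v. v \<in> L ` cube n \<Longrightarrow> norm (T v) = norm v"
    by (rule linfinity_contraction_preserving_norms[of "L ` cube n"]) auto
  have TL: "T (L \<epsilon>) = (\<Sum>j=1..n. cube_Laplacian_inv n (cube_D n j (cube_proj n j (\<lambda>\<eta> \<delta>. T (F \<eta> \<delta>)))) \<epsilon>)"
    for \<epsilon>
    unfolding L_def sum_cube_Laplacian_inv_D_proj
    by (simp add: linear_sum[OF T(1)] linear_scale[OF T(1)])
  have "cube_expect n (\<lambda>\<epsilon>. norm (L \<epsilon>) powr p) = cube_expect n (\<lambda>\<epsilon>. norm (T (L \<epsilon>)) powr p)"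
    by (simp add: cube_expect_def T(3))
  then have "cube_expect n (\<lambda>\<epsilon>. norm (L \<epsilon>) powr p) powr (1 / p)
      \<le> optimal_constant p' * sqrt n *
        cube_expect n (\<lambda>\<epsilon>. cube_expect n (\<lambda>\<delta>. norm (T (F \<epsilon> \<delta>)) powr p)) powr (1 / p)"
    using optimal_constant_linfinity[OF assms, of "\<lambda>\<eta> \<delta>. T (F \<eta> \<delta>)"] by (simp add: TL)
  also have "\<dots> \<le> optimal_constant p' * sqrt n *
        cube_expect n (\<lambda>\<epsilon>. cube_expect n (\<lambda>\<delta>. norm (F \<epsilon> \<delta>) powr p)) powr (1 / p)"
  proof (intro mult_left_mono powr_mono2)
    show "cube_expect n (\<lambda>\<epsilon>. cube_expect n (\<lambda>\<delta>. norm (T (F \<epsilon> \<delta>)) powr p))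
        \<le> cube_expect n (\<lambda>\<epsilon>. cube_expect n (\<lambda>\<delta>. norm (F \<epsilon> \<delta>) powr p))"
      unfolding cube_expect_def using assms(1)
      by (intro scaleR_left_mono sum_mono powr_mono2 T(2)) auto
    show "0 \<le> cube_expect n (\<lambda>\<epsilon>. cube_expect n (\<lambda>\<delta>. norm (T (F \<epsilon> \<delta>)) powr p))"
      by (auto simp: cube_expect_def intro!: mult_nonneg_nonneg sum_nonneg)
  qed (use assms optimal_constant_nonneg[OF assms] in auto)
  finally show ?thesis
    by (simp add: L_def)
qed

end
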